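(* For $t\in[0,d]$ the stochastic error term $S_{t,\lambda}$ satisfies: (a) $S_{t,\lambda}=0$ if $\xi=0$; (b) $S_{0,\lambda}=0$ and $S_{d,\lambda}=\|\xi\|^2$; (c) $S_{t,\lambda}\le\big\|\big((|r_t'(0)|x)^{1/2}\wedge1\big)(AA^\top)\xi\big\|^2$; (d) $S_{t,\lambda}$ is nondecreasing in $t$; (e) $S_{t,\lambda}$ is continuous in $t$. For $t\in[0,d]$ the approximation error term $A_{t,\lambda}$ satisfies: (f) $A_{t,\lambda}\le0$ if $Af=0$; (g) $A_{0,\lambda}=\|Af\|^2$ and $A_{d,\lambda}=0$; (h) $A_{t,\lambda}\le\|r_{t,<}^{1/2}(AA^\top)g\|^2\le\big\|\exp(-|r_t'(0)|x/2)(AA^\top)g\big\|^2$; (i) the upper bound $\|r_{t,<}^{1/2}(AA^\top)g\|^2$ is nonincreasing in $t$; (j) $A_{t,\lambda}$ is continuous in $t$.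
   Context: Model: $D\ge 3$ and $P\ge D$ are integers, $A\in\mathbb{R}^{D\times P}$ has rank $D$, $f\in\mathbb{R}^P$, $g=Af$, $\xi\in\mathbb{R}^D$ is an arbitrary error vector, and $Y=g+\xi$. $\|\cdot\|$ is the Euclidean norm. Let $\lambda_1\ge\dots\ge\lambda_D>0$ be the nonzero singular values of $A$ (with multiplicity), $u_i$ the left singular vectors, $\tilde\lambda_1>\dots>\tilde\lambda_d>0$ the distinct singular values. Put $Y_i=\langle Y,u_i\rangle$. For a function $h$ on $[0,\infty)$ and $w\in\mathbb{R}^D$, $h(AA^\top)w=\sum_{i=1}^D h(\lambda_i^2)\langle w,u_i\rangle u_i$; an expression in $x$ followed by $(AA^\top)$ denotes the corresponding function of $x$ applied to $AA^\top$. Standing assumption: $\sum_{j:\lambda_j=\lambda_i}Y_j^2>0$ for all $i=1,\dots,D$. $a\wedge b=\min(a,b)$. Interpolated conjugate gradient residual polynomials: for $k=0,\dots,d$, $r_k$ is the unique minimiser of $\|p(AA^\top)Y\|^2$ over real polynomials $p$ of degree at most $k$ with $p(0)=1$. For $t=k+\alpha$, $k\in\{0,\dots,d-1\}$, $\alpha\in(0,1]$, $r_t=(1-\alpha)r_k+\alpha r_{k+1}$. $R_t^2=\|r_t(AA^\top)Y\|^2$. For $t\in(0,d]$, $x_{1,t}$ is the smallest zero of $r_t$ on $[0,\infty)$ and $r_{t,<}(x)=r_t(x)\mathbf 1(x<x_{1,t})$; $r_{0,<}\equiv1$. Error terms: $S_{t,\lambda}=\|(1-r_{t,<})^{1/2}(AA^\top)\xi\|^2$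 and $A_{t,\lambda}=\|r_{t,<}^{1/2}(AA^\top)g\|^2+R_t^2-\|r_{t,<}^{1/2}(AA^\top)Y\|^2$. *)

theory Defs
  imports "HOL-Analysis.Analysis" "HOL-Computational_Algebra.Polynomial"
begin

text \<open>Singular systems are indexed by \<open>1, \<dots>, rank A\<close>, as in the decomposition
  \<open>A = \<Sum>\<^sub>i \<lambda>\<^sub>i u\<^sub>i v\<^sub>i\<^sup>T\<close>; the matrix equation is written entrywise.\<close>

definition orthonormal_upto :: "nat \<Rightarrow> (nat \<Rightarrow> 'a::real_inner) \<Rightarrow> bool" where
  "orthonormal_upto n u \<longleftrightarrow>
     (\<forall>i\<in>{1..n}. \<forall>j\<in>{1..n}. u i \<bullet> u j = (if i = j then 1 else 0))"

definition compact_svd ::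
  "real^'p^'d \<Rightarrow> (nat \<Rightarrow> real) \<Rightarrow> (nat \<Rightarrow> real^'d) \<Rightarrow> (nat \<Rightarrow> real^'p) \<Rightarrow> bool" where
  "compact_svd A lam u v \<longleftrightarrow>
     (\<forall>i\<in>{1..rank A}. 0 < lam i) \<and> antimono_on {1..rank A} lam \<and>
     orthonormal_upto (rank A) u \<and> orthonormal_upto (rank A) v \<and>
     A = (\<chi> a b. \<Sum>i=1..rank A. lam i * u i $ a * v i $ b)"

text \<open>In the following, \<open>lam\<close> and \<open>u\<close> are the singular values and left singular vectors of a
  matrix \<open>A\<close> of full row rank \<open>CARD('d)\<close>, so that \<open>spec_app lam u h w\<close> is \<open>h(A A\<^sup>T) w\<close>.\<close>

definition spec_app ::
  "(nat \<Rightarrow> real) \<Rightarrow> (nat \<Rightarrow> real^'d) \<Rightarrow> (real \<Rightarrow> real) \<Rightarrow> real^'d \<Rightarrow> real^'d" where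
  "spec_app lam u h w = (\<Sum>i=1..CARD('d). (h ((lam i)\<^sup>2) * (w \<bullet> u i)) *\<^sub>R u i)"

definition is_cg_minimiser ::
  "(nat \<Rightarrow> real) \<Rightarrow> (nat \<Rightarrow> real^'d) \<Rightarrow> real^'d \<Rightarrow> nat \<Rightarrow> real poly \<Rightarrow> bool" where
  "is_cg_minimiser lam u Y k p \<longleftrightarrow> degree p \<le> k \<and> poly p 0 = 1 \<and>
     (\<forall>q. degree q \<le> k \<and> poly q 0 = 1 \<longrightarrow>
        (norm (spec_app lam u (poly p) Y))\<^sup>2 \<le> (norm (spec_app lam u (poly q) Y))\<^sup>2)"

definition cg_poly ::
  "(nat \<Rightarrow> real) \<Rightarrow> (nat \<Rightarrow> real^'d) \<Rightarrow> real^'d \<Rightarrow> nat \<Rightarrow> real poly" where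
  "cg_poly lam u Y k = (THE p. is_cg_minimiser lam u Y k p)"

text \<open>A positive \<open>t\<close> is written uniquely as \<open>t = k + \<alpha>\<close> with \<open>k\<close> a natural number and
  \<open>0 < \<alpha> \<le> 1\<close>, namely with \<open>k = \<lceil>t\<rceil> - 1\<close>.\<close>

definition icg_poly ::
  "(nat \<Rightarrow> real) \<Rightarrow> (nat \<Rightarrow> real^'d) \<Rightarrow> real^'d \<Rightarrow> real \<Rightarrow> real poly" where
  "icg_poly lam u Y t =
     (if t \<le> 0 then cg_poly lam u Y 0
      else let k = nat (\<lceil>t\<rceil> - 1); \<alpha> = t - real k
           in smult (1 - \<alpha>) (cg_poly lam u Y k) + smult \<alpha> (cg_poly lam u Y (k + 1)))"

definition first_zero ::
  "(nat \<Rightarrow> real) \<Rightarrow> (nat \<Rightarrow> real^'d) \<Rightarrow> real^'d \<Rightarrow> real \<Rightarrow> real" where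
  "first_zero lam u Y t = (LEAST x. 0 \<le> x \<and> poly (icg_poly lam u Y t) x = 0)"

definition r_less ::
  "(nat \<Rightarrow> real) \<Rightarrow> (nat \<Rightarrow> real^'d) \<Rightarrow> real^'d \<Rightarrow> real \<Rightarrow> real \<Rightarrow> real" where
  "r_less lam u Y t x =
     (if t \<le> 0 then 1
      else if x < first_zero lam u Y t then poly (icg_poly lam u Y t) x else 0)"

definition sq_residual ::
  "(nat \<Rightarrow> real) \<Rightarrow> (nat \<Rightarrow> real^'d) \<Rightarrow> real^'d \<Rightarrow> real \<Rightarrow> real" where
  "sq_residual lam u Y t = (norm (spec_app lam u (poly (icg_poly lam u Y t)) Y))\<^sup>2"

definition abs_deriv0 ::
  "(nat \<Rightarrow> real) \<Rightarrow> (nat \<Rightarrow> real^'d) \<Rightarrow> real^'d \<Rightarrow> real \<Rightarrow> real" where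
  "abs_deriv0 lam u Y t = \<bar>poly (pderiv (icg_poly lam u Y t)) 0\<bar>"

definition stoch_err ::
  "(nat \<Rightarrow> real) \<Rightarrow> (nat \<Rightarrow> real^'d) \<Rightarrow> real^'d \<Rightarrow> real^'d \<Rightarrow> real \<Rightarrow> real" where
  "stoch_err lam u Y \<xi> t = (norm (spec_app lam u (\<lambda>x. sqrt (1 - r_less lam u Y t x)) \<xi>))\<^sup>2"

definition approx_err ::
  "(nat \<Rightarrow> real) \<Rightarrow> (nat \<Rightarrow> real^'d) \<Rightarrow> real^'d \<Rightarrow> real^'d \<Rightarrow> real \<Rightarrow> real" where
  "approx_err lam u Y g t =
     (norm (spec_app lam u (\<lambda>x. sqrt (r_less lam u Y t x)) g))\<^sup>2 + sq_residual lam u Y t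
     - (norm (spec_app lam u (\<lambda>x. sqrt (r_less lam u Y t x)) Y))\<^sup>2"

end

(* The residual polynomials r_k are orthogonal polynomials for the spectral measure of Y
   multiplied by x, and r_t is orthogonal to one degree less than r_{k+1}. Counting sign changes
   shows r_t = prod (1 - x/a) with distinct positive zeros a. The bounds (c) and (h) follow from
   the Weierstrass product inequality and from 1 - y <= exp (-y). For (d), (e), (i), (j) the point
   is that r_{k+1}/r_k is nonincreasing up to the first zero of r_k, since the Wronskian of r_k
   and r_{k+1} is nonpositive by the Christoffel-Darboux identity; hence r_{t,<} is the positive
   part of r_t where x lies below the first zero of r_k, and 0 elsewhere. Finally R_t^2 is
   bounded by testing r_t against its quotient by 1 - x/x_1, which lies in [0,1] below x_1. *)

theory Submission
  imports Defs
begin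

section \<open>Real polynomials with positive zeros\<close>

text \<open>The first zero of r_t is awkward as a function of t: at t = 0 there is none, and as t
  decreases to an integer k one of the k + 1 zeros escapes to infinity. The proof therefore never
  follows it. With x \<ge> 0 fixed, truncation is rephrased as positivity on [0, x], and between k
  and k + 1 the cut depends on r_k alone; what remains is affine in t up to a positive part. Since
  every norm is a finite sum over the eigenvalues of A A^T, a statement for each fixed x is enough.
  A second obstacle is the zero count for noninteger t. Orthogonality to degrees below k yields only
  k sign changes, while r_t has degree k + 1; the last zero is located by comparing the sign of the
  leading coefficient with the value 1 at 0.\<close>

lemma poly_eq_0_if_degree_less_card:
  fixes p :: "real poly"
  assumes "finite Z" "\<And>z. z \<in> Z \<Longrightarrow> poly p z = 0" "degree p < card Z"
  shows "p = 0"
proof (rule ccontr)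
  assume "p \<noteq> 0"
  then have "card Z \<le> card {x. poly p x = 0}"
    using assms by (intro card_mono poly_roots_finite) auto
  then show False using card_poly_roots_bound[OF \<open>p \<noteq> 0\<close>] assms(3) by simp
qed

lemma poly_const_sign_if_no_pos_root:
  fixes p :: "real poly"
  assumes "\<And>x. x > 0 \<Longrightarrow> poly p x \<noteq> 0"
  shows "(\<forall>x>0. poly p x \<ge> 0) \<or> (\<forall>x>0. poly p x \<le> 0)"
proof (rule ccontr)
  assume "\<not> ?thesis"
  then obtain a b where ab: "a > 0" "poly p a < 0" "b > 0" "poly p b > 0"
    by (auto simp: not_le)
  show False
  proof (cases "a < b")
    case True
    then obtain x where "a < x" "poly p x = 0" using poly_IVT_pos[of a b p] ab by auto
    then show False using assms[of x] ab by auto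
  next
    case False
    then have "b < a" using ab by (cases "a = b") auto
    then obtain x where "b < x" "poly p x = 0" using poly_IVT_neg[of b a p] ab by auto
    then show False using assms[of x] ab by auto
  qed
qed

text \<open>The set \<open>S\<close> is forced to be the positive zeros of odd multiplicity, that
  is, the sign changes of \<open>p\<close> on the positive axis; zeros of even multiplicity go into
  \<open>B\<close>.\<close>

lemma poly_sign_change_factorization:
  fixes p :: "real poly"
  assumes "p \<noteq> 0"
  obtains S B where "finite S" "\<forall>a\<in>S. a > 0" "p = (\<Prod>a\<in>S. [:-a, 1:]) * B"
    "(\<forall>x>0. poly B x \<ge> 0) \<or> (\<forall>x>0. poly B x \<le> 0)"
proof -
  have "\<exists>S B. finite S \<and> (\<forall>a\<in>S. a > 0) \<and> p = (\<Prod>a\<in>S. [:-a, 1:]) * B \<and>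
     ((\<forall>x>0. poly B x \<ge> 0) \<or> (\<forall>x>0. poly B x \<le> 0))"
    using assms
  proof (induction "degree p" arbitrary: p rule: less_induct)
    case less
    show ?case
    proof (cases "\<exists>c>0. poly p c = 0")
      case False
      then show ?thesis
        using poly_const_sign_if_no_pos_root[of p] by (intro exI[of _ "{}"] exI[of _ p]) auto
    next
      case True
      then obtain c p' where c: "c > 0" and p: "p = [:-c, 1:] * p'"
        by (auto simp: poly_eq_0_iff_dvd dvd_def)
      have p': "p' \<noteq> 0" "degree p' < degree p"
        using less.prems p by (auto simp: degree_mult_eq simp del: mult_pCons_left)
      from less.hyps[OF p'(2,1)] obtain S B where SB: "finite S" "\<forall>a\<in>S. a > 0"
        "p' = (\<Prod>a\<in>S. [:-a, 1:]) * B"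
        "(\<forall>x>0. poly B x \<ge> 0) \<or> (\<forall>x>0. poly B x \<le> 0)" by blast
      show ?thesis
      proof (cases "c \<in> S")
        case False
        then show ?thesis using SB c p
          by (intro exI[of _ "insert c S"] exI[of _ B])
             (simp add: mult.assoc del: mult_pCons_left)
      next
        case True
        \<comment> \<open>A zero met a second time is no longer a sign change: both factors move
          into the cofactor, where their square leaves the sign unaffected.\<close>
        let ?B = "[:-c, 1:] * [:-c, 1:] * B"
        have pos: "poly ?B x = (x - c)\<^sup>2 * poly B x" for x
          by (simp add: power2_eq_square algebra_simps)
        have "p = (\<Prod>a\<in>S - {c}. [:-a, 1:]) * ?B"
          unfolding p SB(3) prod.remove[OF SB(1) True]
          by (simp only: mult.assoc mult.left_commute)
        moreover have "(\<forall>x>0. poly ?B x \<ge> 0) \<or> (\<forall>x>0. poly ?B x \<le> 0)"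
          unfolding pos using SB(4) by (auto intro: mult_nonneg_nonpos)
        ultimately show ?thesis using SB(1,2)
          by (intro exI[of _ "S - {c}"] exI[of _ ?B]) auto
      qed
    qed
  qed
  then show ?thesis using that by blast
qed

lemma degree_prod_linear:
  "finite S \<Longrightarrow> degree (\<Prod>a\<in>S. [:-a, 1:] :: real poly) = card S"
  by (subst degree_prod_eq_sum_degree) auto

lemma prod_linear_dvd:
  fixes p :: "real poly"
  assumes "finite S" "\<And>a. a \<in> S \<Longrightarrow> poly p a = 0"
  shows "(\<Prod>a\<in>S. [:-a, 1:]) dvd p"
  using assms
proof (induction S arbitrary: p rule: finite_induct)
  case (insert c S)
  then obtain q where q: "p = [:-c, 1:] * q" by (auto simp: poly_eq_0_iff_dvd dvd_def)
  have "poly q a = 0" if "a \<in> S" for a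
    using insert.prems[of a] insert.hyps(2) that unfolding q by auto
  then have "(\<Prod>a\<in>S. [:-a, 1:]) dvd q" by (rule insert.IH)
  then show ?case unfolding q prod.insert[OF insert.hyps] by (intro mult_dvd_mono) auto
qed simp

text \<open>With every factor equal to 1 at 0, a residual polynomial with simple positive zeros is
  determined by its zero set; the empty set gives the constant 1.\<close>

definition root_poly :: "real set \<Rightarrow> real poly" where
  "root_poly S = (\<Prod>a\<in>S. [:1, - (1 / a):])"

lemma poly_root_poly: "poly (root_poly S) x = (\<Prod>a\<in>S. 1 - x / a)"
  by (simp add: root_poly_def poly_prod)

lemma poly_root_poly_0 [simp]: "poly (root_poly S) 0 = 1"
  by (simp add: poly_root_poly)

lemma prod_linear_eq_root_poly:
  assumes "finite S" "\<forall>a\<in>S. a > (0::real)"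
    and "poly ((\<Prod>a\<in>S. [:-a, 1:]) * [:c:]) 0 = 1"
  shows "(\<Prod>a\<in>S. [:-a, 1:]) * [:c:] = root_poly S"
proof -
  have lin: "[:-a, 1:] = smult (-a) [:1, - (1 / a):]" if "a \<in> S" for a
    using assms(2) that by auto
  have "(\<Prod>a\<in>S. [:-a, 1:]) = (\<Prod>a\<in>S. smult (-a) [:1, - (1 / a):])"
    by (rule prod.cong[OF refl lin])
  also have "\<dots> = smult (\<Prod>a\<in>S. -a) (root_poly S)"
    unfolding root_poly_def by (rule prod_smult)
  finally have eq: "(\<Prod>a\<in>S. [:-a, 1:]) * [:c:] = smult (c * (\<Prod>a\<in>S. -a)) (root_poly S)"
    by (simp add: mult.commute)
  then have "c * (\<Prod>a\<in>S. -a) = 1" using assms(3) by simp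
  then show ?thesis using eq by simp
qed

lemma degree_root_poly:
  assumes "\<forall>a\<in>S. a > 0"
  shows "degree (root_poly S) = card S"
proof -
  have "degree (root_poly S) = (\<Sum>a\<in>S. degree [:1, - (1 / a):])"
    unfolding root_poly_def by (rule degree_prod_eq_sum_degree) simp
  also have "\<dots> = (\<Sum>a\<in>S. 1)"
    by (intro sum.cong) (use assms in auto)
  finally show ?thesis by simp
qed

text \<open>The alternating sign is used twice: to place the last zero of an interpolated
  polynomial, and to fix the sign of the Christoffel-Darboux factor.\<close>

lemma coeff_root_poly:
  assumes "\<forall>a\<in>S. a > 0"
  shows "(-1) ^ card S * coeff (root_poly S) (card S) > 0"
proof -
  have "coeff (root_poly S) (card S) = (\<Prod>a\<in>S. - (1 / a))"
  proof -
    have "coeff (root_poly S) (card S) = lead_coeff (root_poly S)"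
      using degree_root_poly[OF assms] by simp
    also have "\<dots> = (\<Prod>a\<in>S. lead_coeff [:1, - (1 / a):])"
      unfolding root_poly_def by (rule lead_coeff_prod)
    also have "\<dots> = (\<Prod>a\<in>S. - (1 / a))"
      by (intro prod.cong) (use assms in auto)
    finally show ?thesis .
  qed
  also have "\<dots> = (-1) ^ card S * (\<Prod>a\<in>S. 1 / a)"
    by (simp add: prod_uminus)
  finally show ?thesis
    using assms by (simp add: mult.assoc[symmetric] power_mult_distrib[symmetric] prod_pos)
qed

lemma abs_pderiv_root_poly:
  assumes "\<forall>a\<in>S. a > 0"
  shows "\<bar>poly (pderiv (root_poly S)) 0\<bar> = (\<Sum>a\<in>S. 1 / a)"
proof -
  have "poly (pderiv (root_poly S)) 0 = - (\<Sum>a\<in>S. 1 / a)"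
    unfolding root_poly_def pderiv_prod poly_sum
    by (simp add: poly_prod pderiv_pCons sum_negf)
  moreover have "(\<Sum>a\<in>S. 1 / a) \<ge> 0" using assms by (intro sum_nonneg) (auto simp: less_imp_le)
  ultimately show ?thesis by simp
qed

lemma one_minus_sum_le_prod:
  fixes f :: "'b \<Rightarrow> real"
  assumes "finite S" "\<And>a. a \<in> S \<Longrightarrow> 0 \<le> f a \<and> f a \<le> 1"
  shows "1 - sum f S \<le> (\<Prod>a\<in>S. 1 - f a)"
  using assms
proof (induction S rule: finite_induct)
  case (insert c S)
  have P: "0 \<le> (\<Prod>a\<in>S. 1 - f a)" "(\<Prod>a\<in>S. 1 - f a) \<le> 1"
    using insert.prems by (auto intro!: prod_nonneg prod_le_1)
  have "f c * (\<Prod>a\<in>S. 1 - f a) \<le> f c"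
    using P insert.prems by (intro mult_left_le) auto
  moreover have "1 - sum f S \<le> (\<Prod>a\<in>S. 1 - f a)" using insert by auto
  ultimately show ?case using insert.hyps by (simp add: algebra_simps)
qed simp

section \<open>Truncation at the first zero\<close>

definition pos_upto :: "real poly \<Rightarrow> real \<Rightarrow> bool" where
  "pos_upto p x \<longleftrightarrow> (\<forall>y\<in>{0..x}. 0 < poly p y)"

text \<open>For a polynomial with value 1 at 0 and x \<ge> 0, being positive on [0, x] means lying
  before the first zero. This also makes sense when there is no zero, and it allows two polynomials
  to be compared without locating their zeros.\<close>

definition trunc_poly :: "real poly \<Rightarrow> real \<Rightarrow> real" where
  "trunc_poly p x = (if pos_upto p x then poly p x else 0)"

lemma pos_upto_root_poly:
  assumes "finite S" "\<forall>a\<in>S. a > 0" "x \<ge> 0"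
  shows "pos_upto (root_poly S) x \<longleftrightarrow> (\<forall>a\<in>S. x < a)"
proof
  assume l: "pos_upto (root_poly S) x"
  show "\<forall>a\<in>S. x < a"
  proof (rule ccontr)
    assume "\<not> (\<forall>a\<in>S. x < a)"
    then obtain a where a: "a \<in> S" "a \<le> x" by auto
    then have "poly (root_poly S) a > 0" using l assms(2) by (auto simp: pos_upto_def)
    moreover have "poly (root_poly S) a = 0"
      using a assms(1) assms(2) unfolding poly_root_poly by (intro prod_zero) auto
    ultimately show False by simp
  qed
next
  assume r: "\<forall>a\<in>S. x < a"
  show "pos_upto (root_poly S) x"
    unfolding pos_upto_def poly_root_poly
    using r assms by (auto intro!: prod_pos simp: divide_simps)
qed

lemma trunc_poly_le_1:
  assumes "finite S" "\<forall>a\<in>S. a > 0" "x \<ge> 0"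
  shows "0 \<le> trunc_poly (root_poly S) x" "trunc_poly (root_poly S) x \<le> 1"
  using assms
  by (auto simp: trunc_poly_def pos_upto_root_poly[OF assms] poly_root_poly divide_simps
        intro!: prod_nonneg prod_le_1 dest!: bspec)

lemma one_minus_trunc_poly_le:
  assumes S: "finite S" "\<forall>a\<in>S. a > 0" and x: "x \<ge> 0"
  shows "1 - trunc_poly (root_poly S) x \<le> \<bar>poly (pderiv (root_poly S)) 0\<bar> * x"
proof (cases "pos_upto (root_poly S) x")
  case True
  then have "\<forall>a\<in>S. x < a" using pos_upto_root_poly[OF assms] by simp
  then have "1 - (\<Sum>a\<in>S. x / a) \<le> (\<Prod>a\<in>S. 1 - x / a)"
    using S x by (intro one_minus_sum_le_prod) (auto simp: divide_simps less_imp_le)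
  then show ?thesis using True
    by (simp add: trunc_poly_def poly_root_poly abs_pderiv_root_poly[OF S(2)] sum_distrib_right)
next
  case False
  then obtain a where a: "a \<in> S" "a \<le> x" using pos_upto_root_poly[OF assms] by (auto simp: not_less)
  \<comment> \<open>Past the smallest zero the left side is 1, and the summand of a single zero a
    \<le> x already reaches 1.\<close>
  have "1 \<le> 1 / a * x" using a S(2) by (simp add: divide_simps)
  also have "\<dots> \<le> (\<Sum>a\<in>S. 1 / a) * x"
    using a S x by (intro mult_right_mono member_le_sum) (auto simp: less_imp_le)
  finally show ?thesis using False
    by (simp add: trunc_poly_def abs_pderiv_root_poly[OF S(2)])
qed

lemma trunc_poly_le_exp:
  assumes S: "finite S" "\<forall>a\<in>S. a > 0" and x: "x \<ge> 0"
  shows "trunc_poly (root_poly S) x \<le> exp (- (\<bar>poly (pderiv (root_poly S)) 0\<bar> * x))"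
proof (cases "pos_upto (root_poly S) x")
  case True
  then have xa: "\<forall>a\<in>S. x < a" using pos_upto_root_poly[OF assms] by simp
  have "(\<Prod>a\<in>S. 1 - x / a) \<le> (\<Prod>a\<in>S. exp (- (x / a)))"
    using xa S x exp_ge_add_one_self[of "- (x / a)" for a]
    by (intro prod_mono) (auto simp: divide_simps less_imp_le)
  also have "\<dots> = exp (- (\<Sum>a\<in>S. x / a))"
    using S by (simp add: exp_sum sum_negf[symmetric])
  finally show ?thesis using True
    by (simp add: trunc_poly_def poly_root_poly abs_pderiv_root_poly[OF S(2)] sum_distrib_right)
qed (simp add: trunc_poly_def)

section \<open>Residual polynomials of a discrete measure\<close>

text \<open>The factor z beside the weight comes from the constraint at 0: two competitors of degree
  at most n with value 1 at 0 differ by x h(x) with degree h < n. For n = 0 orthogonality is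
  vacuous. The bound n \<le> card Z is the range in which minimisers are unique.\<close>

locale residual_polys =
  fixes Z :: "real set" and w :: "real \<Rightarrow> real" and r :: "nat \<Rightarrow> real poly"
  assumes finite_Z: "finite Z"
    and Z_pos: "z \<in> Z \<Longrightarrow> 0 < z"
    and w_pos: "z \<in> Z \<Longrightarrow> 0 < w z"
    and degree_r: "n \<le> card Z \<Longrightarrow> degree (r n) \<le> n"
    and poly_r_0: "n \<le> card Z \<Longrightarrow> poly (r n) 0 = 1"
    and orth_r: "n \<le> card Z \<Longrightarrow> degree h < n \<Longrightarrow>
          (\<Sum>z\<in>Z. w z * z * poly (r n) z * poly h z) = 0"
begin

lemma weighted_sum_eq_0:
  assumes "(\<Sum>z\<in>Z. w z * z * F z) = 0" "(\<forall>z\<in>Z. F z \<ge> 0) \<or> (\<forall>z\<in>Z. F z \<le> 0)" "z \<in> Z"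
  shows "F z = 0"
proof -
  have nonneg: "G z = 0" if "(\<Sum>z\<in>Z. w z * z * G z) = 0" "\<And>z. z \<in> Z \<Longrightarrow> G z \<ge> 0" for G
  proof -
    have "w z * z * G z = 0"
      using sum_nonneg_0[OF finite_Z _ that(1) assms(3)] that(2) Z_pos w_pos
      by (simp add: less_imp_le)
    then show ?thesis using Z_pos[OF assms(3)] w_pos[OF assms(3)] by simp
  qed
  have "(\<Sum>z\<in>Z. w z * z * - F z) = 0" using assms(1) by (simp add: sum_negf)
  then show ?thesis using nonneg[of F] nonneg[of "\<lambda>z. - F z"] assms(1,2) by force
qed

text \<open>Multiplying \<open>p\<close> by the product of \<open>x - a\<close> over its sign changes \<open>a\<close> gives a function of
  constant sign, so orthogonality to all polynomials of degree below \<open>m\<close> forces \<open>m\<close> sign changes.\<close>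

lemma orth_imp_factorization:
  assumes p: "degree p \<le> card Z" "m \<le> card Z" "p \<noteq> 0"
    and orth: "\<And>h. degree h < m \<Longrightarrow> (\<Sum>z\<in>Z. w z * z * poly p z * poly h z) = 0"
  obtains S B where "finite S" "\<forall>a\<in>S. a > 0" "p = (\<Prod>a\<in>S. [:-a, 1:]) * B"
    "m \<le> card S" "(\<forall>x>0. poly B x \<ge> 0) \<or> (\<forall>x>0. poly B x \<le> 0)"
proof -
  obtain S B where SB: "finite S" "\<forall>a\<in>S. a > 0" "p = (\<Prod>a\<in>S. [:-a, 1:]) * B"
    "(\<forall>x>0. poly B x \<ge> 0) \<or> (\<forall>x>0. poly B x \<le> 0)"
    using poly_sign_change_factorization[OF p(3)] by metis
  show ?thesis
  proof (cases "m \<le> card S")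
    case True
    then show ?thesis using SB that by blast
  next
    case False
    let ?h = "\<Prod>a\<in>S. [:-a, 1:]"
    have "(\<Sum>z\<in>Z. w z * z * (poly p z * poly ?h z)) = 0"
      using orth[of ?h] False SB(1) by (simp add: degree_prod_linear mult.assoc)
    moreover have "poly p z * poly ?h z = (poly ?h z)\<^sup>2 * poly B z" for z
      unfolding SB(3) by (simp add: power2_eq_square)
    then have "(\<forall>z\<in>Z. poly p z * poly ?h z \<ge> 0) \<or> (\<forall>z\<in>Z. poly p z * poly ?h z \<le> 0)"
      using SB(4) Z_pos by (auto intro: mult_nonneg_nonpos)
    ultimately have "poly p z * poly ?h z = 0" if "z \<in> Z" for z
      using weighted_sum_eq_0[of "\<lambda>z. poly p z * poly ?h z" z] that by blast
    then have "poly p z = 0" if "z \<in> Z" for z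
      using that unfolding SB(3) by auto
    \<comment> \<open>As \<open>p\<close> vanishes on \<open>Z\<close> and has degree at most card
      Z, it is a constant multiple of the product over \<open>Z\<close>. Hence \<open>Z\<close>
      itself serves as the set of sign changes.\<close>
    then have "(\<Prod>a\<in>Z. [:-a, 1:]) dvd p" by (rule prod_linear_dvd[OF finite_Z])
    then obtain C where C: "p = (\<Prod>a\<in>Z. [:-a, 1:]) * C" by (auto simp: dvd_def)
    have "degree p = card Z + degree C"
      using p(3) unfolding C by (subst degree_mult_eq) (auto simp: degree_prod_linear finite_Z)
    then have "degree C = 0" using p(1) by simp
    then obtain c where "C = [:c:]" by (rule degree_eq_zeroE)
    then have "(\<forall>x>0. poly C x \<ge> 0) \<or> (\<forall>x>0. poly C x \<le> 0)" by auto
    then show ?thesis using that[of Z C] finite_Z Z_pos C p(2) by blast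
  qed
qed

text \<open>Orthogonality supplies at least n sign changes and the degree permits no more, so the
  cofactor is constant and the value at 0 determines it.\<close>

lemma r_eq_root_poly:
  assumes n: "n \<le> card Z"
  obtains S where "finite S" "\<forall>a\<in>S. a > 0" "card S = n" "r n = root_poly S"
proof -
  have nz: "r n \<noteq> 0" using poly_r_0[OF n] by auto
  have deg: "degree (r n) \<le> card Z" using degree_r[OF n] n by simp
  obtain S B where SB: "finite S" "\<forall>a\<in>S. a > 0"
    "r n = (\<Prod>a\<in>S. [:-a, 1:]) * B" "n \<le> card S"
    "(\<forall>x>0. poly B x \<ge> 0) \<or> (\<forall>x>0. poly B x \<le> 0)"
    by (rule orth_imp_factorization[OF deg n nz orth_r[OF n]])
  have "degree (r n) = card S + degree B"
    using nz unfolding SB(3)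
    by (subst degree_mult_eq) (auto simp: degree_prod_linear SB(1))
  then have "degree B = 0" "card S = n" using degree_r[OF n] SB(4) by auto
  from this(1) obtain c where c: "B = [:c:]" by (rule degree_eq_zeroE)
  have "r n = root_poly S"
    using prod_linear_eq_root_poly[OF SB(1,2), of c] poly_r_0[OF n] unfolding SB(3) c by blast
  then show ?thesis using that[of S] SB(1,2) \<open>card S = n\<close> by blast
qed

lemma r_0 [simp]: "r 0 = 1"
proof -
  obtain S where "finite S" "\<forall>a\<in>S. a > 0" "card S = 0" "r 0 = root_poly S"
    by (rule r_eq_root_poly[OF le0])
  then show ?thesis by (simp add: root_poly_def)
qed

lemma coeff_r:
  assumes n: "n \<le> card Z"
  shows "(-1) ^ n * coeff (r n) n > 0"
proof -
  obtain S where S: "finite S" "\<forall>a\<in>S. a > 0" "card S = n" "r n = root_poly S"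
    using n by (rule r_eq_root_poly)
  have "(-1) ^ card S * coeff (root_poly S) (card S) > 0" by (rule coeff_root_poly[OF S(2)])
  then show ?thesis unfolding S(3) S(4) .
qed

section \<open>Zeros of the interpolated polynomials\<close>

definition interp :: "nat \<Rightarrow> real \<Rightarrow> real poly" where
  "interp k \<alpha> = smult (1 - \<alpha>) (r k) + smult \<alpha> (r (Suc k))"

lemma poly_interp: "poly (interp k \<alpha>) x = (1 - \<alpha>) * poly (r k) x + \<alpha> * poly (r (Suc k)) x"
  by (simp add: interp_def)

text \<open>Both neighbours are orthogonal to degrees below k, which gives k sign changes. If there
  were no further one, the cofactor would be linear. The leading coefficient, which comes from
  r_{k+1} alone and is nonzero because \<alpha> > 0, and the value 1 at 0 give its two coefficients
  opposite signs. It would then change sign at a positive point, a contradiction.\<close>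

lemma interp_eq_root_poly:
  assumes k: "k < card Z" and \<alpha>: "0 < \<alpha>"
  obtains S where "finite S" "\<forall>a\<in>S. a > 0" "card S = Suc k" "interp k \<alpha> = root_poly S"
proof -
  let ?p = "interp k \<alpha>"
  have deg: "degree ?p \<le> Suc k"
    unfolding interp_def using degree_r[of k] degree_r[of "Suc k"] k
    by (intro degree_add_le) (auto intro: order_trans[OF degree_smult_le])
  have p0: "poly ?p 0 = 1" using k by (simp add: poly_interp poly_r_0)
  then have p_nz: "?p \<noteq> 0" by auto
  have "coeff (r k) (Suc k) = 0" using degree_r[of k] k by (intro coeff_eq_0) auto
  then have "(-1) ^ Suc k * coeff ?p (Suc k) = \<alpha> * ((-1) ^ Suc k * coeff (r (Suc k)) (Suc k))"
    by (simp add: interp_def)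
  then have lc: "(-1) ^ Suc k * coeff ?p (Suc k) > 0"
    using coeff_r[of "Suc k"] k \<alpha> by (metis Suc_leI mult_pos_pos)
  have "(\<Sum>z\<in>Z. w z * z * poly ?p z * poly h z) = 0" if "degree h < k" for h
  proof -
    have "(\<Sum>z\<in>Z. w z * z * poly ?p z * poly h z)
        = (1 - \<alpha>) * (\<Sum>z\<in>Z. w z * z * poly (r k) z * poly h z)
          + \<alpha> * (\<Sum>z\<in>Z. w z * z * poly (r (Suc k)) z * poly h z)"
      by (simp add: poly_interp sum_distrib_left sum.distrib[symmetric] algebra_simps)
    then show ?thesis using orth_r[of k h] orth_r[of "Suc k" h] k that by simp
  qed
  note orth = this
  have "degree ?p \<le> card Z" "k \<le> card Z" using deg k by auto
  then obtain S B where SB: "finite S"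
    "\<forall>a\<in>S. a > 0" "?p = (\<Prod>a\<in>S. [:-a, 1:]) * B" "k \<le> card S"
    "(\<forall>x>0. poly B x \<ge> 0) \<or> (\<forall>x>0. poly B x \<le> 0)"
    using p_nz orth by (rule orth_imp_factorization)
  have degS: "degree (\<Prod>a\<in>S. [:-a, 1:]) = card S" by (rule degree_prod_linear[OF SB(1)])
  have dB: "degree ?p = card S + degree B"
    using p_nz unfolding SB(3) by (subst degree_mult_eq) (auto simp: degS)
  have cS: "card S = Suc k \<and> degree B = 0"
  proof (rule ccontr)
    assume "\<not> ?thesis"
    then have cS: "card S = k" using dB deg SB(4) by auto
    have "coeff ?p (Suc k) \<noteq> 0" using lc by auto
    then have "Suc k \<le> degree ?p" by (rule le_degree)
    with deg have "degree ?p = Suc k" by (rule antisym)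
    then have dB1: "degree B = 1" using dB cS by simp
    then obtain b0 b1 where B: "B = [:b0, b1:]" "b1 \<noteq> 0" by (rule degree1_coeffs)
    have "coeff ?p (Suc k) = b1"
    proof -
      have "lead_coeff ?p = lead_coeff (\<Prod>a\<in>S. [:-a, 1:]) * lead_coeff B"
        unfolding SB(3) by (rule lead_coeff_mult)
      then show ?thesis
        using dB1 \<open>degree ?p = Suc k\<close>
        by (simp add: lead_coeff_prod B split: if_splits)
    qed
    then have b1: "(-1) ^ k * b1 < 0" using lc by simp
    have "(\<Prod>a\<in>S. - a) * b0 = 1" using p0 by (simp add: SB(3) B poly_prod mult.commute)
    then have "(\<Prod>a\<in>S. a) * ((-1) ^ k * b0) = 1"
      by (simp add: prod_uminus cS mult.assoc mult.left_commute)
    moreover have "(\<Prod>a\<in>S. a) > 0" using SB(2) by (intro prod_pos) auto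
    ultimately have b0: "(-1) ^ k * b0 > 0"
      using zero_less_mult_pos[of "\<Prod>a\<in>S. a" "(-1) ^ k * b0"] by simp
    have b: "b0 * b1 < 0" using b0 b1 by (cases "even k") (auto simp: mult_less_0_iff)
    \<comment> \<open>This is the zero of the linear cofactor; at x/2 and 2x the cofactor takes the
      values b0/2 and -b0, which have opposite signs.\<close>
    define x where "x = - b0 / b1"
    have x: "x > 0" "b1 * x = - b0"
      using b B(2) by (auto simp: x_def divide_less_0_iff mult_less_0_iff)
    have "poly B (2 * x) = b0 + 2 * (b1 * x)" "poly B (x / 2) = b0 + b1 * x / 2" by (auto simp: B)
    then have "poly B (2 * x) = - b0" "poly B (x / 2) = b0 / 2" unfolding x(2) by auto
    moreover have "2 * x > 0" "x / 2 > 0" using x(1) by auto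
    ultimately have "0 \<le> - b0 \<and> 0 \<le> b0 / 2 \<or> - b0 \<le> 0 \<and> b0 / 2 \<le> 0" using SB(5) by metis
    then have "b0 = 0" by auto
    then show False using b by simp
  qed
  then obtain c where c: "B = [:c:]" by (auto elim: degree_eq_zeroE)
  have "?p = root_poly S"
    using prod_linear_eq_root_poly[OF SB(1,2), of c] p0 unfolding SB(3) c by blast
  then show ?thesis using that[of S] SB(1,2) cS by blast
qed

lemma weighted_sq_sum_pos:
  assumes "p \<noteq> 0" "degree p < card Z"
  shows "0 < (\<Sum>z\<in>Z. w z * z * (poly p z)\<^sup>2)"
proof -
  have nonneg: "0 \<le> w z * z * (poly p z)\<^sup>2" if "z \<in> Z" for z
    using that Z_pos w_pos by (simp add: less_imp_le)
  have "(\<Sum>z\<in>Z. w z * z * (poly p z)\<^sup>2) \<noteq> 0"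
  proof
    assume "(\<Sum>z\<in>Z. w z * z * (poly p z)\<^sup>2) = 0"
    then have "poly p z = 0" if "z \<in> Z" for z
      using weighted_sum_eq_0[of "\<lambda>z. (poly p z)\<^sup>2" z] that by simp
    then show False using poly_eq_0_if_degree_less_card[OF finite_Z] assms by blast
  qed
  moreover have "0 \<le> (\<Sum>z\<in>Z. w z * z * (poly p z)\<^sup>2)" by (rule sum_nonneg) (rule nonneg)
  ultimately show ?thesis by linarith
qed

text \<open>Christoffel--Darboux: the Wronskian at \<open>y\<close> is the value at \<open>y\<close> of
  \<open>q(x) = (r\<^sub>k(y) r\<^sub>k\<^sub>+\<^sub>1(x) - r\<^sub>k\<^sub>+\<^sub>1(y) r\<^sub>k(x)) / (x - y)\<close>,
  and \<open>q\<close> is, up to a factor, the reproducing kernel at \<open>y\<close>.\<close>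

lemma wronskian_nonpos:
  assumes k: "k < card Z" and y: "poly (r k) y \<noteq> 0"
  shows "poly (pderiv (r (Suc k))) y * poly (r k) y
           - poly (r (Suc k)) y * poly (pderiv (r k)) y \<le> 0"
proof -
  define p where "p = smult (poly (r k) y) (r (Suc k)) - smult (poly (r (Suc k)) y) (r k)"
  define q where "q = synthetic_div p y"
  define N where "N = (\<Sum>z\<in>Z. w z * z * poly q z)"
  have dk: "degree (r k) \<le> k" "degree (r (Suc k)) \<le> Suc k"
    using degree_r[of k] degree_r[of "Suc k"] k by auto
  have p: "p = [:-y, 1:] * q"
    using synthetic_div_correct'[of y p] by (simp add: q_def p_def del: mult_pCons_left)
  have pz: "poly p z = (z - y) * poly q z" for z
    unfolding p by (simp add: algebra_simps)
  have "degree p \<le> Suc k"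
    unfolding p_def using dk
    by (intro degree_diff_le) (auto intro: order_trans[OF degree_smult_le])
  then have dq: "degree q \<le> k" by (simp add: q_def degree_synthetic_div)
  have W: "poly q y = poly (pderiv (r (Suc k))) y * poly (r k) y
           - poly (r (Suc k)) y * poly (pderiv (r k)) y"
  proof -
    have "poly (pderiv p) y = poly q y"
      unfolding p pderiv_mult by (simp add: pderiv_pCons)
    then show ?thesis by (simp add: p_def pderiv_diff pderiv_smult mult.commute)
  qed
  have cq: "coeff q k = poly (r k) y * coeff (r (Suc k)) (Suc k)"
  proof -
    have "coeff p (Suc k) = coeff q k"
      using dq unfolding p by (simp add: coeff_eq_0)
    then show ?thesis using dk(1) by (simp add: p_def coeff_eq_0)
  qed
  \<comment> \<open>Reproducing property: write h = (x - y) g + h(y). The factor x - y turns q into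
    p, which is orthogonal to g, so only the constant h(y) contributes.\<close>
  have repr: "(\<Sum>z\<in>Z. w z * z * (poly q z * poly h z)) = poly h y * N" if h: "degree h \<le> k" for h
  proof -
    define g where "g = synthetic_div h y"
    have hz: "poly h z = (z - y) * poly g z + poly h y" for z
    proof -
      have "poly h z = poly ([:-y, 1:] * g + [:poly h y:]) z"
        unfolding g_def synthetic_div_correct' ..
      then show ?thesis by (simp add: algebra_simps)
    qed
    have "(\<Sum>z\<in>Z. w z * z * poly p z * poly g z) = 0"
    \<comment> \<open>For k = 0 the bound degree g < k is impossible, even for the zero polynomial;
      there g = 0 is used directly.\<close>
    proof (cases "k = 0")
      case True
      then have "g = 0" using h by (simp add: g_def synthetic_div_eq_0_iff)
      then show ?thesis by simp
    next
      case False
      then have "degree g < k" using h by (simp add: g_def degree_synthetic_div)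
      then have "(\<Sum>z\<in>Z. w z * z * poly (r k) z * poly g z) = 0"
        "(\<Sum>z\<in>Z. w z * z * poly (r (Suc k)) z * poly g z) = 0"
        using orth_r[of k g] orth_r[of "Suc k" g] k by auto
      moreover have "(\<Sum>z\<in>Z. w z * z * poly p z * poly g z)
        = poly (r k) y * (\<Sum>z\<in>Z. w z * z * poly (r (Suc k)) z * poly g z)
          - poly (r (Suc k)) y * (\<Sum>z\<in>Z. w z * z * poly (r k) z * poly g z)"
        unfolding p_def
        by (simp add: sum_distrib_left sum_subtractf[symmetric] algebra_simps)
      ultimately show ?thesis by simp
    qed
    moreover have "(\<Sum>z\<in>Z. w z * z * (poly q z * poly h z))
      = (\<Sum>z\<in>Z. w z * z * poly p z * poly g z) + poly h y * N"
      unfolding N_def sum_distrib_left sum.distrib[symmetric]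
      by (intro sum.cong refl, subst hz) (simp add: pz algebra_simps)
    ultimately show ?thesis by simp
  qed
  \<comment> \<open>Testing with h = q shows q(y) N \<ge> 0, so it suffices to prove N < 0.\<close>
  have "0 \<le> (\<Sum>z\<in>Z. w z * z * (poly q z * poly q z))"
    using Z_pos w_pos by (intro sum_nonneg) (auto simp: less_imp_le)
  then have WN: "0 \<le> poly q y * N" using repr[OF dq] by simp
  define M where "M = (\<Sum>z\<in>Z. w z * z * (poly (r k) z)\<^sup>2)"
  have "r k \<noteq> 0" using poly_r_0[of k] k by auto
  then have M: "0 < M" unfolding M_def using dk k by (intro weighted_sq_sum_pos) auto
  have lc: "coeff (r k) k * coeff (r (Suc k)) (Suc k) < 0"
    using coeff_r[of k] coeff_r[of "Suc k"] k
    by (cases "even k") (auto simp: mult_less_0_iff)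
  then have lck: "coeff (r k) k \<noteq> 0" by auto
  \<comment> \<open>This ratio cancels the leading term, so q - c r_k is orthogonal to r_k. Testing
    with h = r_k then gives r_k(y) N = c M. Since c contains the factor r_k(y), it cancels, and the
    sign of N is that of the quotient of consecutive leading coefficients.\<close>
  define c where "c = coeff q k / coeff (r k) k"
  define e where "e = q - smult c (r k)"
  have "(\<Sum>z\<in>Z. w z * z * poly (r k) z * poly e z) = 0"
  proof -
    have de: "degree e \<le> k" unfolding e_def using dk dq
      by (intro degree_diff_le) (auto intro: order_trans[OF degree_smult_le])
    have "coeff e k = 0" using lck by (simp add: e_def c_def)
    then have "e = 0 \<or> degree e < k" using de by (metis le_neq_implies_less leading_coeff_0_iff)
    then show ?thesis using orth_r[of k e] k by auto
  qed
  moreover have "(\<Sum>z\<in>Z. w z * z * (poly q z * poly (r k) z))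
    = (\<Sum>z\<in>Z. w z * z * poly (r k) z * poly e z) + c * M"
    unfolding M_def e_def sum_distrib_left sum.distrib[symmetric]
    by (intro sum.cong) (auto simp: algebra_simps power2_eq_square)
  ultimately have "poly (r k) y * N = c * M" using repr[OF dk(1)] by simp
  then have N: "N = coeff (r (Suc k)) (Suc k) / coeff (r k) k * M"
    using y lck by (simp add: c_def cq field_simps)
  have "coeff (r (Suc k)) (Suc k) / coeff (r k) k < 0"
    using lc by (auto simp: divide_less_0_iff mult_less_0_iff)
  then have "N < 0" unfolding N using M by (rule mult_neg_pos)
  then have "poly q y \<le> 0" using WN by (auto simp: zero_le_mult_iff)
  then show ?thesis using W by simp
qed

section \<open>Comparison of consecutive residual polynomials\<close>

lemma ratio_antimono:
  assumes k: "k < card Z" and pos: "pos_upto (r k) x" and y: "0 \<le> y" "y \<le> x"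
  shows "poly (r (Suc k)) x * poly (r k) y \<le> poly (r (Suc k)) y * poly (r k) x"
proof -
  have nz: "poly (r k) t > 0" if "y \<le> t" "t \<le> x" for t
    using pos that y by (auto simp: pos_upto_def)
  have "poly (r (Suc k)) x / poly (r k) x \<le> poly (r (Suc k)) y / poly (r k) y"
  proof (rule DERIV_nonpos_imp_nonincreasing[OF y(2)])
    fix t assume t: "y \<le> t" "t \<le> x"
    let ?D = "(poly (pderiv (r (Suc k))) t * poly (r k) t
           - poly (r (Suc k)) t * poly (pderiv (r k)) t) / (poly (r k) t * poly (r k) t)"
    have "DERIV (\<lambda>t. poly (r (Suc k)) t / poly (r k) t) t :> ?D"
      using nz[OF t] by (intro DERIV_divide poly_DERIV) auto
    moreover have "?D \<le> 0"
      using wronskian_nonpos[OF k, of t] nz[OF t] by (intro divide_nonpos_pos) auto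
    ultimately show "\<exists>D. DERIV (\<lambda>t. poly (r (Suc k)) t / poly (r k) t) t :> D \<and> D \<le> 0"
      by blast
  qed
  then show ?thesis using nz[of x] nz[of y] y by (simp add: divide_simps mult.commute)
qed

lemma r_Suc_le_r:
  assumes "k < card Z" "pos_upto (r k) x" "0 \<le> x"
  shows "poly (r (Suc k)) x \<le> poly (r k) x"
  using ratio_antimono[OF assms(1,2), of 0] assms by (simp add: poly_r_0)

text \<open>At the first zero a \<le> x of r_k also r_{k+1}(a) \<le> 0, so every interpolant between
  them is nonpositive at a.\<close>

lemma not_pos_upto_interp:
  assumes k: "k < card Z" and \<alpha>: "0 \<le> \<alpha>" "\<alpha> \<le> 1" and x: "0 \<le> x" "\<not> pos_upto (r k) x"
  shows "\<not> pos_upto (interp k \<alpha>) x"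
proof -
  obtain S where S: "finite S" "\<forall>a\<in>S. a > 0" "card S = k" "r k = root_poly S"
    using less_imp_le[OF k] by (rule r_eq_root_poly)
  define a where "a = Min S"
  have ex: "\<exists>a\<in>S. a \<le> x"
    using x(2) unfolding S(4) pos_upto_root_poly[OF S(1,2) x(1)] by (simp add: not_less)
  then have "S \<noteq> {}" by auto
  then have a: "a \<in> S" "\<And>b. b \<in> S \<Longrightarrow> a \<le> b" using S(1) by (auto simp: a_def)
  then have "a \<le> x" "0 < a" using ex S(2) by fastforce+
  have "poly (r k) a = 0"
    unfolding S(4) poly_root_poly using S(1,2) a(1) by (intro prod_zero) auto
  have "poly (r (Suc k) - r k) a \<le> 0"
  \<comment> \<open>The comparison r_{k+1} \<le> r_k requires r_k to be positive at the point
    itself, so at a it is obtained as a limit from the left.\<close>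
  proof (rule tendsto_upperbound)
    show "((\<lambda>y. poly (r (Suc k) - r k) y) \<longlongrightarrow> poly (r (Suc k) - r k) a) (at_left a)"
      by (intro tendsto_poly tendsto_ident_at)
    show "\<forall>\<^sub>F y in at_left a. poly (r (Suc k) - r k) y \<le> 0"
      using eventually_at_left_real[OF \<open>0 < a\<close>]
    proof eventually_elim
      case (elim y)
      then have "pos_upto (r k) y"
        unfolding S(4) using a(2) by (subst pos_upto_root_poly[OF S(1,2)]) force+
      then show ?case using r_Suc_le_r[OF k] elim by simp
    qed
  qed simp
  then have "poly (interp k \<alpha>) a \<le> 0"
    using \<open>poly (r k) a = 0\<close> \<alpha> by (simp add: poly_interp mult_nonneg_nonpos)
  then show ?thesis using \<open>a \<le> x\<close> \<open>0 < a\<close> by (auto simp: pos_upto_def not_less intro!: bexI[of _ a])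
qed

lemma trunc_poly_interp:
  assumes k: "k < card Z" and \<alpha>: "0 \<le> \<alpha>" "\<alpha> \<le> 1" and x: "0 \<le> x"
  shows "trunc_poly (interp k \<alpha>) x =
           (if pos_upto (r k) x then max 0 (poly (interp k \<alpha>) x) else 0)"
proof (cases "pos_upto (r k) x")
  case False
  then show ?thesis using not_pos_upto_interp[OF assms] by (simp add: trunc_poly_def)
next
  case True
  \<comment> \<open>The quotient of the interpolant by r_k is (1 - \<alpha>) + \<alpha> r_{k+1}/r_k,
    which is nonincreasing on [0, x]; positivity at x thus passes to every smaller y. The
    computation is this argument with denominators cleared.\<close>
  have "pos_upto (interp k \<alpha>) x" if px: "0 < poly (interp k \<alpha>) x"
    unfolding pos_upto_def
  proof
    fix y assume y: "y \<in> {0..x}"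
    have ry: "poly (r k) y > 0" "poly (r k) x > 0" using True x y by (auto simp: pos_upto_def)
    have "0 < poly (r k) y * poly (interp k \<alpha>) x" using px ry by simp
    also have "\<dots> = (1 - \<alpha>) * poly (r k) y * poly (r k) x
        + \<alpha> * (poly (r (Suc k)) x * poly (r k) y)"
      by (simp add: poly_interp algebra_simps)
    also have "\<dots> \<le> (1 - \<alpha>) * poly (r k) y * poly (r k) x
        + \<alpha> * (poly (r (Suc k)) y * poly (r k) x)"
      using ratio_antimono[OF k True, of y] y \<alpha> by (intro add_left_mono mult_left_mono) auto
    also have "\<dots> = poly (interp k \<alpha>) y * poly (r k) x"
      by (simp add: poly_interp algebra_simps)
    finally show "0 < poly (interp k \<alpha>) y" using ry by (simp add: zero_less_mult_iff)
  qed
  moreover have "\<not> pos_upto (interp k \<alpha>) x" if "\<not> 0 < poly (interp k \<alpha>) x"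
    using that x by (auto simp: pos_upto_def)
  ultimately show ?thesis using True by (cases "0 < poly (interp k \<alpha>) x") (auto simp: trunc_poly_def)
qed

lemma trunc_poly_interp_antimono:
  assumes k: "k < card Z" and \<alpha>: "0 \<le> \<alpha>" "\<alpha> \<le> \<beta>" "\<beta> \<le> 1" and x: "0 \<le> x"
  shows "trunc_poly (interp k \<beta>) x \<le> trunc_poly (interp k \<alpha>) x"
proof (cases "pos_upto (r k) x")
  case True
  have "(\<beta> - \<alpha>) * poly (r (Suc k)) x \<le> (\<beta> - \<alpha>) * poly (r k) x"
    using r_Suc_le_r[OF k True x] \<alpha> by (intro mult_left_mono) auto
  then have "poly (interp k \<beta>) x \<le> poly (interp k \<alpha>) x"
    by (simp add: poly_interp algebra_simps)
  then show ?thesis using assms by (subst (1 2) trunc_poly_interp) auto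
qed (use assms in \<open>simp add: trunc_poly_interp\<close>)

section \<open>Projection property and residual norms\<close>

lemma inner_r:
  assumes n: "n \<le> card Z" and q: "degree q \<le> n" "poly q 0 = 1"
  shows "(\<Sum>z\<in>Z. w z * (poly (r n) z * poly q z)) = (\<Sum>z\<in>Z. w z * (poly (r n) z)\<^sup>2)"
proof -
  \<comment> \<open>The difference q - r_n vanishes at 0, hence equals x h. The factor x turns the
    plain inner product into the one for which r_n is orthogonal to h.\<close>
  define h where "h = synthetic_div (q - r n) 0"
  have qz: "poly q z = poly (r n) z + z * poly h z" for z
  proof -
    have "poly (q - r n) z = poly ([:-0, 1:] * h + [:poly (q - r n) 0:]) z"
      unfolding h_def synthetic_div_correct' ..
    then show ?thesis using q n by (simp add: poly_r_0)
  qed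
  have "degree (q - r n) \<le> n" using q degree_r[OF n] by (intro degree_diff_le) auto
  then have "n = 0 \<and> h = 0 \<or> degree h < n"
    by (cases n) (auto simp: h_def degree_synthetic_div synthetic_div_eq_0_iff)
  then have "(\<Sum>z\<in>Z. w z * z * poly (r n) z * poly h z) = 0"
    using orth_r[OF n] by auto
  moreover have "(\<Sum>z\<in>Z. w z * (poly (r n) z * poly q z))
      = (\<Sum>z\<in>Z. w z * (poly (r n) z)\<^sup>2) + (\<Sum>z\<in>Z. w z * z * poly (r n) z * poly h z)"
    unfolding qz sum.distrib[symmetric]
    by (intro sum.cong) (auto simp: algebra_simps power2_eq_square)
  ultimately show ?thesis by simp
qed

text \<open>The polynomial with zero set \<open>Z\<close> is an admissible competitor of degree card
  Z with zero residual, so the projection property makes the residual of r_{card Z} vanish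
  too.\<close>

lemma poly_r_card_Z:
  assumes z: "z \<in> Z"
  shows "poly (r (card Z)) z = 0"
proof -
  have "poly (root_poly Z) x = 0" if "x \<in> Z" for x
    unfolding poly_root_poly using finite_Z Z_pos[OF that] that by (intro prod_zero) auto
  then have "(\<Sum>z\<in>Z. w z * (poly (r (card Z)) z * poly (root_poly Z) z)) = 0" by simp
  moreover have "degree (root_poly Z) = card Z" using Z_pos by (intro degree_root_poly) auto
  ultimately have "(\<Sum>z\<in>Z. w z * (poly (r (card Z)) z)\<^sup>2) = 0"
    using inner_r[OF le_refl, of "root_poly Z"] by simp
  moreover have "0 \<le> w x * (poly (r (card Z)) x)\<^sup>2" if "x \<in> Z" for x
    using w_pos[OF that] by simp
  ultimately have "w z * (poly (r (card Z)) z)\<^sup>2 = 0"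
    using sum_nonneg_0[OF finite_Z _ _ z, of "\<lambda>x. w x * (poly (r (card Z)) x)\<^sup>2"] by simp
  then show ?thesis using w_pos[OF z] by simp
qed

lemma residual_antimono:
  assumes k: "k < card Z"
  shows "(\<Sum>z\<in>Z. w z * (poly (r (Suc k)) z)\<^sup>2) \<le> (\<Sum>z\<in>Z. w z * (poly (r k) z)\<^sup>2)"
proof -
  have "(\<Sum>z\<in>Z. w z * (poly (r (Suc k)) z * poly (r k) z)) = (\<Sum>z\<in>Z. w z * (poly (r (Suc k)) z)\<^sup>2)"
    using k degree_r[of k] by (intro inner_r) (auto simp: poly_r_0)
  moreover have "0 \<le> (\<Sum>z\<in>Z. w z * (poly (r (Suc k)) z - poly (r k) z)\<^sup>2)"
    using w_pos by (intro sum_nonneg) (auto simp: less_imp_le)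
  moreover have "(\<Sum>z\<in>Z. w z * (poly (r (Suc k)) z - poly (r k) z)\<^sup>2)
     = (\<Sum>z\<in>Z. w z * (poly (r (Suc k)) z)\<^sup>2) + (\<Sum>z\<in>Z. w z * (poly (r k) z)\<^sup>2)
       - 2 * (\<Sum>z\<in>Z. w z * (poly (r (Suc k)) z * poly (r k) z))"
    unfolding sum_distrib_left sum.distrib[symmetric] sum_subtractf[symmetric]
    by (intro sum.cong) (auto simp: algebra_simps power2_eq_square)
  ultimately show ?thesis by linarith
qed

text \<open>The test polynomial is the residual polynomial with its first zero divided out.\<close>

lemma residual_le_trunc:
  assumes k: "k < card Z" and \<alpha>: "0 < \<alpha>" "\<alpha> \<le> 1"
  shows "(\<Sum>z\<in>Z. w z * (poly (interp k \<alpha>) z)\<^sup>2) \<le> (\<Sum>z\<in>Z. w z * trunc_poly (interp k \<alpha>) z)"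
proof -
  let ?p = "interp k \<alpha>"
  obtain S where S: "finite S" "\<forall>a\<in>S. a > 0" "card S = Suc k" "?p = root_poly S"
    using k \<alpha>(1) by (rule interp_eq_root_poly)
  define a where "a = Min S"
  \<comment> \<open>Removing one zero lowers the degree to k, so the projection property applies to
    \<open>q\<close> with both r_k and r_{k+1}. Removing the smallest makes the product with r_t
    equal to (1 - x/a) q^2, nonpositive from a onwards.\<close>
  define q where "q = root_poly (S - {a})"
  have "S \<noteq> {}" using S(3) by auto
  then have a: "a \<in> S" "\<And>b. b \<in> S \<Longrightarrow> a \<le> b" using S(1) by (auto simp: a_def)
  then have "0 < a" using S(2) by auto
  have q: "degree q \<le> k" "poly q 0 = 1"
    unfolding q_def using S a(1) by (auto simp: degree_root_poly)
  have pz: "poly ?p z = (1 - z / a) * poly q z" for z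
    unfolding S(4) q_def poly_root_poly using S(1) a(1) by (subst prod.remove) auto
  define R where "R n = (\<Sum>z\<in>Z. w z * (poly (r n) z)\<^sup>2)" for n
  have inner: "(\<Sum>z\<in>Z. w z * (poly (r k) z * poly q z)) = R k"
    "(\<Sum>z\<in>Z. w z * (poly (r (Suc k)) z * poly q z)) = R (Suc k)"
    "(\<Sum>z\<in>Z. w z * (poly (r (Suc k)) z * poly (r k) z)) = R (Suc k)"
    unfolding R_def using k q degree_r[of k] by (intro inner_r; simp add: poly_r_0)+
  have "(\<Sum>z\<in>Z. w z * (poly ?p z)\<^sup>2)
      = (1 - \<alpha>)\<^sup>2 * R k + \<alpha>\<^sup>2 * R (Suc k)
        + 2 * \<alpha> * (1 - \<alpha>) * (\<Sum>z\<in>Z. w z * (poly (r (Suc k)) z * poly (r k) z))"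
    unfolding R_def sum_distrib_left sum.distrib[symmetric] poly_interp
    by (intro sum.cong) (auto simp: algebra_simps power2_eq_square)
  \<comment> \<open>The cross term equals R (k + 1), so the squared norm falls short of the linear
    interpolation by \<alpha> (1 - \<alpha>) (R k - R (k + 1)), which is nonnegative.\<close>
  also have "\<dots> = (1 - \<alpha>) * R k + \<alpha> * R (Suc k) - \<alpha> * (1 - \<alpha>) * (R k - R (Suc k))"
    unfolding inner by (simp add: algebra_simps power2_eq_square)
  also have "\<dots> \<le> (1 - \<alpha>) * R k + \<alpha> * R (Suc k)"
    using residual_antimono[OF k] \<alpha> by (simp add: R_def)
  also have "\<dots> = (\<Sum>z\<in>Z. w z * (poly ?p z * poly q z))"
    unfolding inner(1,2)[symmetric] sum_distrib_left sum.distrib[symmetric] poly_interp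
    by (intro sum.cong) (auto simp: algebra_simps)
  also have "\<dots> \<le> (\<Sum>z\<in>Z. w z * trunc_poly ?p z)"
  proof (intro sum_mono mult_left_mono)
    fix z assume z: "z \<in> Z"
    then have z0: "0 < z" by (rule Z_pos)
    show "0 \<le> w z" using w_pos[OF z] by simp
    show "poly ?p z * poly q z \<le> trunc_poly ?p z"
    proof (cases "z < a")
      case True
      then have lt: "\<forall>b\<in>S. z < b" using a(2) by fastforce
      then have "pos_upto ?p z" unfolding S(4) using pos_upto_root_poly[OF S(1,2)] z0 by simp
      moreover have "0 \<le> poly ?p z"
        using \<open>pos_upto ?p z\<close> z0 by (auto simp: pos_upto_def less_imp_le)
      moreover have "poly q z \<le> 1"
        unfolding q_def poly_root_poly using lt S(2) z0
        by (intro prod_le_1) (auto simp: divide_simps less_imp_le)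
      ultimately show ?thesis by (simp add: trunc_poly_def mult_left_le)
    next
      case False
      have "poly ?p z * poly q z = (1 - z / a) * (poly q z)\<^sup>2"
        by (simp add: pz power2_eq_square)
      also have "\<dots> \<le> 0" using False \<open>0 < a\<close> by (intro mult_nonpos_nonneg) (auto simp: divide_simps)
      also have "\<dots> \<le> trunc_poly ?p z"
        unfolding S(4) using trunc_poly_le_1(1)[OF S(1,2)] z0 by simp
      finally show ?thesis .
    qed
  qed
  finally show ?thesis .
qed

end

section \<open>Residual polynomials of the spectral measure\<close>

lemma continuous_on_unit_intervals:
  fixes F :: "real \<Rightarrow> real"
  assumes "\<And>k. k < d \<Longrightarrow> continuous_on {real k..real (Suc k)} F"
  shows "continuous_on {0..real d} F"
  using assms
proof (induction d)
  case (Suc d)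
  have eq: "{0..real (Suc d)} = {0..real d} \<union> {real d..real (Suc d)}" by auto
  show ?case unfolding eq using Suc by (intro continuous_on_closed_Un) auto
qed auto

lemma antimono_on_unit_intervals:
  fixes F :: "real \<Rightarrow> real"
  assumes "\<And>k. k < d \<Longrightarrow> antimono_on {real k..real (Suc k)} F"
  shows "antimono_on {0..real d} F"
  using assms
proof (induction d)
  case 0
  show ?case by (auto intro: monotone_onI)
next
  case (Suc d)
  have l: "antimono_on {0..real d} F" using Suc by auto
  have r: "antimono_on {real d..real (Suc d)} F" using Suc.prems by blast
  show ?case
  proof (rule monotone_onI)
    fix x y assume xy: "x \<in> {0..real (Suc d)}" "y \<in> {0..real (Suc d)}" "x \<le> y"
    consider "y \<le> real d" | "x \<ge> real d" | "x \<le> real d" "real d \<le> y" by linarith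
    then show "F x \<ge> F y"
    proof cases
      case 1
      then show ?thesis using xy monotone_onD[OF l, of x y] by simp
    next
      case 2
      then show ?thesis using xy monotone_onD[OF r, of x y] by simp
    next
      case 3
      then show ?thesis
        using xy monotone_onD[OF l, of x "real d"] monotone_onD[OF r, of "real d" y] by simp
    qed
  qed
qed

section \<open>Functional calculus in an orthonormal system\<close>

lemma spec_app_inner:
  fixes u :: "nat \<Rightarrow> real^'d"
  assumes "orthonormal_upto CARD('d) u"
  shows "spec_app lam u h v \<bullet> spec_app lam u h' v' =
    (\<Sum>i=1..CARD('d). h ((lam i)\<^sup>2) * h' ((lam i)\<^sup>2) * ((v \<bullet> u i) * (v' \<bullet> u i)))"
proof -
  have comp: "spec_app lam u h v \<bullet> u j = h ((lam j)\<^sup>2) * (v \<bullet> u j)" if "j \<in> {1..CARD('d)}" for j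
  proof -
    have "spec_app lam u h v \<bullet> u j = (\<Sum>i=1..CARD('d). (h ((lam i)\<^sup>2) * (v \<bullet> u i)) * (u i \<bullet> u j))"
      by (simp add: spec_app_def inner_sum_left)
    also have "\<dots> = (\<Sum>i=1..CARD('d). if i = j then h ((lam j)\<^sup>2) * (v \<bullet> u j) else 0)"
      using assms that by (intro sum.cong) (auto simp: orthonormal_upto_def)
    finally show ?thesis using that by simp
  qed
  show ?thesis
    unfolding spec_app_def[of lam u h' v'] inner_sum_right inner_scaleR_right
    by (intro sum.cong) (auto simp: comp)
qed

lemma norm_spec_app:
  fixes u :: "nat \<Rightarrow> real^'d"
  assumes "orthonormal_upto CARD('d) u"
  shows "(norm (spec_app lam u h v))\<^sup>2 =
    (\<Sum>i=1..CARD('d). (h ((lam i)\<^sup>2))\<^sup>2 * (v \<bullet> u i)\<^sup>2)"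
  unfolding power2_norm_eq_inner spec_app_inner[OF assms] by (simp add: power2_eq_square)

text \<open>As many orthonormal vectors as the dimension span the space, so the remainder is
  orthogonal to everything. This yields the exact values in (b) and (g).\<close>

lemma spec_app_1:
  fixes u :: "nat \<Rightarrow> real^'d"
  assumes u: "orthonormal_upto CARD('d) u"
  shows "spec_app lam u (\<lambda>_. 1) v = v"
proof -
  let ?B = "u ` {1..CARD('d)}"
  have inj: "inj_on u {1..CARD('d)}"
  proof (rule inj_onI)
    fix i j assume ij: "i \<in> {1..CARD('d)}" "j \<in> {1..CARD('d)}" "u i = u j"
    show "i = j"
    proof (rule ccontr)
      assume "i \<noteq> j"
      then have "u i \<bullet> u j = 0" "u i \<bullet> u i = 1" using u ij(1,2) by (auto simp: orthonormal_upto_def)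
      then show False using ij(3) by simp
    qed
  qed
  have "pairwise orthogonal ?B"
    using u by (auto simp: pairwise_def orthogonal_def orthonormal_upto_def)
  moreover have "0 \<notin> ?B"
  proof
    assume "0 \<in> ?B"
    then obtain i where i: "i \<in> {1..CARD('d)}" "u i = 0" by auto
    have "u i \<bullet> u i = (if i = i then 1 else 0)"
      using u i(1) unfolding orthonormal_upto_def by blast
    then show False using i(2) by simp
  qed
  ultimately have "independent ?B" by (rule pairwise_orthogonal_independent)
  moreover have "card ?B = CARD('d)" using card_image[OF inj] by simp
  ultimately have span: "UNIV \<subseteq> span ?B"
    by (intro card_ge_dim_independent) auto
  define s where "s = v - spec_app lam u (\<lambda>_. 1) v"
  have "orthogonal s x" for x
  proof (rule orthogonal_to_span)
    show "x \<in> span ?B" using span by auto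
    fix y assume "y \<in> ?B"
    then obtain j where j: "j \<in> {1..CARD('d)}" "y = u j" by auto
    have "spec_app lam u (\<lambda>_. 1) v \<bullet> u j = (\<Sum>i=1..CARD('d). (v \<bullet> u i) * (u i \<bullet> u j))"
      by (simp add: spec_app_def inner_sum_left)
    also have "\<dots> = (\<Sum>i=1..CARD('d). if i = j then v \<bullet> u j else 0)"
      using u j by (intro sum.cong) (auto simp: orthonormal_upto_def)
    also have "\<dots> = v \<bullet> u j" using j by simp
    finally show "orthogonal s y" by (simp add: s_def orthogonal_def inner_diff_left j)
  qed
  then have "s = 0" by (simp add: orthogonal_self[symmetric])
  then show ?thesis by (simp add: s_def)
qed

section \<open>The spectral measure of Y and its minimisers\<close>

locale cg_setting =
  fixes lam :: "nat \<Rightarrow> real" and u :: "nat \<Rightarrow> real^'d" and Y :: "real^'d"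
  assumes lam_pos: "i \<in> {1..CARD('d)} \<Longrightarrow> 0 < lam i"
    and orthonormal: "orthonormal_upto CARD('d) u"
    and Y_pos: "i \<in> {1..CARD('d)} \<Longrightarrow>
          0 < (\<Sum>j | j \<in> {1..CARD('d)} \<and> lam j = lam i. (Y \<bullet> u j)\<^sup>2)"
begin

definition nodes :: "real set" where
  "nodes = (\<lambda>i. (lam i)\<^sup>2) ` {1..CARD('d)}"

text \<open>Coefficients belonging to a multiple singular value are pooled into one atom. The
  measure then has d atoms, and the standing assumption on \<open>Y\<close> says that each has
  positive mass.\<close>

definition weight :: "real \<Rightarrow> real" where
  "weight z = (\<Sum>i | i \<in> {1..CARD('d)} \<and> (lam i)\<^sup>2 = z. (Y \<bullet> u i)\<^sup>2)"

lemma finite_nodes: "finite nodes"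
  by (simp add: nodes_def)

lemma lam_sq_in_nodes: "i \<in> {1..CARD('d)} \<Longrightarrow> (lam i)\<^sup>2 \<in> nodes"
  by (auto simp: nodes_def)

lemma nodes_pos: "z \<in> nodes \<Longrightarrow> 0 < z"
  using lam_pos by (force simp: nodes_def)

lemma weight_pos:
  assumes "z \<in> nodes"
  shows "0 < weight z"
proof -
  obtain i where i: "i \<in> {1..CARD('d)}" "z = (lam i)\<^sup>2" using assms by (auto simp: nodes_def)
  have "(lam j)\<^sup>2 = z \<longleftrightarrow> lam j = lam i" if "j \<in> {1..CARD('d)}" for j
    using lam_pos[OF i(1)] lam_pos[OF that] unfolding i(2) by (auto simp: power2_eq_iff)
  then have "{j. j \<in> {1..CARD('d)} \<and> (lam j)\<^sup>2 = z} = {j. j \<in> {1..CARD('d)} \<and> lam j = lam i}"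
    by blast
  then show ?thesis using Y_pos[OF i(1)] by (simp only: weight_def)
qed

lemma card_nodes: "card nodes = card (lam ` {1..CARD('d)})"
proof -
  have "nodes = (\<lambda>x. x\<^sup>2) ` lam ` {1..CARD('d)}" by (simp add: nodes_def image_image)
  moreover have "inj_on (\<lambda>x. x\<^sup>2) (lam ` {1..CARD('d)})"
  proof (rule inj_onI)
    fix x y assume "x \<in> lam ` {1..CARD('d)}" "y \<in> lam ` {1..CARD('d)}" "x\<^sup>2 = y\<^sup>2"
    moreover from this(1,2) have "0 \<le> x" "0 \<le> y" using lam_pos less_imp_le by blast+
    ultimately show "x = y" by (simp add: power2_eq_imp_eq)
  qed
  ultimately show ?thesis by (simp add: card_image)
qed

lemma sum_weight:
  "(\<Sum>i=1..CARD('d). F ((lam i)\<^sup>2) * (Y \<bullet> u i)\<^sup>2) = (\<Sum>z\<in>nodes. weight z * F z)"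
proof -
  have "(\<Sum>i=1..CARD('d). F ((lam i)\<^sup>2) * (Y \<bullet> u i)\<^sup>2)
      = (\<Sum>z\<in>nodes. \<Sum>i | i \<in> {1..CARD('d)} \<and> (lam i)\<^sup>2 = z. F ((lam i)\<^sup>2) * (Y \<bullet> u i)\<^sup>2)"
    unfolding nodes_def by (rule sum.image_gen) simp
  also have "\<dots> = (\<Sum>z\<in>nodes. weight z * F z)"
    unfolding weight_def sum_distrib_right by (intro sum.cong refl) auto
  finally show ?thesis .
qed

definition residual :: "real poly \<Rightarrow> real^'d" where
  "residual p = spec_app lam u (poly p) Y"

lemma residual_inner:
  "residual p \<bullet> residual q = (\<Sum>z\<in>nodes. weight z * (poly p z * poly q z))"
  unfolding residual_def spec_app_inner[OF orthonormal] sum_weight[symmetric]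
  by (simp add: power2_eq_square)

lemma residual_add: "residual (p + q) = residual p + residual q"
  by (simp add: residual_def spec_app_def sum.distrib[symmetric] algebra_simps)

lemma residual_smult: "residual (smult c p) = c *\<^sub>R residual p"
  by (simp add: residual_def spec_app_def scaleR_sum_right algebra_simps)

lemma residual_0: "residual 0 = 0"
  by (simp add: residual_def spec_app_def)

lemma residual_diff: "residual (p - q) = residual p - residual q"
  using residual_add[of "p - q" q] by simp

lemma residual_eq_0:
  assumes "residual p = 0" "z \<in> nodes"
  shows "poly p z = 0"
proof -
  have "(\<Sum>z\<in>nodes. weight z * (poly p z * poly p z)) = 0"
    using residual_inner[of p p] assms(1) by simp
  moreover have "0 \<le> weight x * (poly p x * poly p x)" if "x \<in> nodes" for x
    using weight_pos[OF that] by simp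
  ultimately have "weight z * (poly p z * poly p z) = 0"
    using sum_nonneg_0[OF finite_nodes _ _ assms(2), of "\<lambda>x. weight x * (poly p x * poly p x)"] by simp
  then show ?thesis using weight_pos[OF assms(2)] by simp
qed

text \<open>The residuals of competitors form the affine space \<open>residual 1\<close> +
  \<open>V\<close>, so orthogonal decomposition yields a minimiser and its orthogonality at once.
  Two minimisers differ by x g with zero residual; then g vanishes at all nodes, although its degree
  is below their number unless g = 0.\<close>

lemma cg_minimiser_ex1:
  assumes k: "k \<le> card nodes"
  shows "\<exists>p. is_cg_minimiser lam u Y k p \<and> (\<forall>q. is_cg_minimiser lam u Y k q \<longrightarrow> q = p) \<and>
    (\<forall>h. degree h < k \<longrightarrow> residual p \<bullet> residual (pCons 0 h) = 0)"
proof -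
  \<comment> \<open>Vanishing coefficients from k on, unlike degree h < k, admit h = 0 when k = 0,
    so \<open>V\<close> is a subspace in that case too.\<close>
  define V where "V = {residual (pCons 0 h) | h. \<forall>i\<ge>k. coeff h i = 0}"
  have "subspace V"
  proof (rule subspaceI)
    show "0 \<in> V" unfolding V_def by (auto intro!: exI[of _ 0] simp: residual_0)
  next
    fix x y assume "x \<in> V" "y \<in> V"
    then obtain h h' where "x = residual (pCons 0 h)" "\<forall>i\<ge>k. coeff h i = 0"
      "y = residual (pCons 0 h')" "\<forall>i\<ge>k. coeff h' i = 0" unfolding V_def by auto
    then show "x + y \<in> V" unfolding V_def
      by (auto intro!: exI[of _ "h + h'"] simp: residual_add[symmetric])
  next
    fix c x assume "x \<in> V"
    then obtain h where "x = residual (pCons 0 h)" "\<forall>i\<ge>k. coeff h i = 0" unfolding V_def by auto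
    then show "c *\<^sub>R x \<in> V" unfolding V_def
      by (auto intro!: exI[of _ "smult c h"] simp: residual_smult[symmetric])
  qed
  then have span: "span V = V" by (simp add: span_eq_iff)
  obtain y z where yz: "y \<in> span V" "\<And>x. x \<in> span V \<Longrightarrow> orthogonal z x" "residual 1 = y + z"
    using orthogonal_subspace_decomp_exists[of V "residual 1"] by auto
  obtain h where h: "y = residual (pCons 0 h)" "\<forall>i\<ge>k. coeff h i = 0"
    using yz(1) unfolding span unfolding V_def by auto
  define p where "p = 1 - pCons 0 h"
  have rp: "residual p = z" using yz(3) by (simp add: p_def residual_diff h(1))
  have orth: "residual p \<bullet> residual (pCons 0 g) = 0" if "\<forall>i\<ge>k. coeff g i = 0" for g
    using yz(2)[of "residual (pCons 0 g)"] that unfolding span rp orthogonal_def unfolding V_def by blast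
  have deg: "degree p \<le> k" "poly p 0 = 1"
    using h(2) by (auto simp: p_def coeff_pCons intro!: degree_le split: nat.splits)
  have dec: "\<exists>g. q = p + pCons 0 g \<and> (\<forall>i\<ge>k. coeff g i = 0)"
    if q: "degree q \<le> k" "poly q 0 = 1" for q
  proof -
    obtain c g where cg: "q - p = pCons c g" by (rule pCons_cases)
    have "c = poly (q - p) 0" unfolding cg by simp
    then have c: "c = 0" using q(2) deg(2) by simp
    have "coeff g i = 0" if "i \<ge> k" for i
    proof -
      have "coeff g i = coeff (q - p) (Suc i)" unfolding cg by simp
      then show ?thesis using q(1) deg(1) that by (simp add: coeff_eq_0)
    qed
    moreover have "q = p + pCons 0 g" using cg c by (simp add: algebra_simps)
    ultimately show ?thesis by blast
  qed
  have pyth: "(norm (residual (p + pCons 0 g)))\<^sup>2 = (norm (residual p))\<^sup>2 + (norm (residual (pCons 0 g)))\<^sup>2"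
    if "\<forall>i\<ge>k. coeff g i = 0" for g
    unfolding residual_add using orth[OF that] by (intro norm_add_Pythagorean) (simp add: orthogonal_def)
  have min: "is_cg_minimiser lam u Y k p"
    unfolding is_cg_minimiser_def residual_def[symmetric]
  proof (intro conjI allI impI deg)
    fix q :: "real poly" assume "degree q \<le> k \<and> poly q 0 = 1"
    then obtain g where "q = p + pCons 0 g" "\<forall>i\<ge>k. coeff g i = 0" using dec by blast
    then show "(norm (residual p))\<^sup>2 \<le> (norm (residual q))\<^sup>2" using pyth by simp
  qed
  have "q = p" if q: "is_cg_minimiser lam u Y k q" for q
  proof -
    have "degree q \<le> k" "poly q 0 = 1" using q by (auto simp: is_cg_minimiser_def)
    then obtain g where g: "q = p + pCons 0 g" "\<forall>i\<ge>k. coeff g i = 0" using dec by blast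
    have "(norm (residual q))\<^sup>2 \<le> (norm (residual p))\<^sup>2"
      using q deg unfolding is_cg_minimiser_def residual_def[symmetric] by blast
    then have "residual (pCons 0 g) = 0" using pyth[OF g(2)] unfolding g(1) by simp
    then have z: "poly g z = 0" if "z \<in> nodes" for z
      using residual_eq_0[of "pCons 0 g" z] nodes_pos[OF that] that by simp
    have "g = 0"
    proof (rule ccontr)
      assume "g \<noteq> 0"
      then have "degree g < k" using g(2) leading_coeff_0_iff[of g] by (meson not_le)
      then show False using poly_eq_0_if_degree_less_card[OF finite_nodes, of g] z k \<open>g \<noteq> 0\<close> by simp
    qed
    then show ?thesis using g(1) by simp
  qed
  moreover have "residual p \<bullet> residual (pCons 0 g) = 0" if "degree g < k" for g
    using that by (intro orth) (auto intro: coeff_eq_0)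
  ultimately show ?thesis using min by blast
qed

lemma cg_poly_props:
  assumes k: "k \<le> card nodes"
  shows "is_cg_minimiser lam u Y k (cg_poly lam u Y k)"
    and "degree h < k \<Longrightarrow> residual (cg_poly lam u Y k) \<bullet> residual (pCons 0 h) = 0"
proof -
  obtain p where p: "is_cg_minimiser lam u Y k p" "\<forall>q. is_cg_minimiser lam u Y k q \<longrightarrow> q = p"
    "\<forall>h. degree h < k \<longrightarrow> residual p \<bullet> residual (pCons 0 h) = 0"
    using cg_minimiser_ex1[OF k] by blast
  have "cg_poly lam u Y k = p" unfolding cg_poly_def using p(1,2) by (intro the_equality) blast+
  then show "is_cg_minimiser lam u Y k (cg_poly lam u Y k)"
    and "degree h < k \<Longrightarrow> residual (cg_poly lam u Y k) \<bullet> residual (pCons 0 h) = 0"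
    using p(1,3) by (simp_all only:)
qed

sublocale residual_polys nodes weight "cg_poly lam u Y"
proof
  fix n assume n: "n \<le> card nodes"
  show "degree (cg_poly lam u Y n) \<le> n" "poly (cg_poly lam u Y n) 0 = 1"
    using cg_poly_props(1)[OF n] by (auto simp: is_cg_minimiser_def)
  fix h :: "real poly" assume "degree h < n"
  from cg_poly_props(2)[OF n this]
  show "(\<Sum>z\<in>nodes. weight z * z * poly (cg_poly lam u Y n) z * poly h z) = 0"
    unfolding residual_inner by (simp add: mult_ac)
qed (use finite_nodes nodes_pos weight_pos in auto)

section \<open>Interpolated residual polynomials and error terms\<close>

abbreviation icg :: "real \<Rightarrow> real poly" where
  "icg \<equiv> icg_poly lam u Y"

text \<open>Both endpoints are included: an integer t is reached with \<alpha> = 1 from the left and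
  \<alpha> = 0 from the right. The agreement of these two forms is what allows closed unit intervals
  to be glued.\<close>

lemma icg_eq_interp:
  assumes "real k \<le> t" "t \<le> real (Suc k)"
  shows "icg t = interp k (t - real k)"
proof (cases "t = real k")
  case True
  show ?thesis
  proof (cases k)
    case 0
    then show ?thesis using True by (simp add: icg_poly_def interp_def)
  next
    case (Suc j)
    then have "t = of_int (int (Suc j))" "t > 0" using True by auto
    then have "\<lceil>t\<rceil> = int (Suc j)" "t > 0" by (simp_all only: ceiling_of_int)
    then show ?thesis using True Suc by (simp add: icg_poly_def interp_def)
  qed
next
  case False
  then have "\<lceil>t\<rceil> = int k + 1" "t > 0" using assms by (auto simp: ceiling_eq_iff)
  then show ?thesis by (simp add: icg_poly_def interp_def Let_def)
qed

lemma icg_cases: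
  assumes "t \<in> {0..real (card nodes)}"
  obtains "t = 0" | k where "k < card nodes" "real k < t" "t \<le> real (Suc k)"
proof (cases "t = 0")
  case False
  define k where "k = nat (\<lceil>t\<rceil> - 1)"
  have "0 < t" "t \<le> real (card nodes)" using assms False by auto
  then have "1 \<le> \<lceil>t\<rceil>" "\<lceil>t\<rceil> \<le> int (card nodes)" by (simp_all add: ceiling_le_iff one_le_ceiling)
  then have k: "int k = \<lceil>t\<rceil> - 1" by (simp add: k_def)
  then have "k < card nodes" using \<open>\<lceil>t\<rceil> \<le> int (card nodes)\<close> by linarith
  moreover have "real k = of_int \<lceil>t\<rceil> - 1" using k by (metis of_int_1 of_int_diff of_int_of_nat_eq)
  then have "real k < t" "t \<le> real (Suc k)" by (simp_all, linarith+)
  ultimately show ?thesis using that(2) by blast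
qed (use that in blast)

lemma icg_root_poly:
  assumes "t \<in> {0..real (card nodes)}"
  obtains S where "finite S" "\<forall>a\<in>S. a > 0" "icg t = root_poly S" "t > 0 \<longrightarrow> S \<noteq> {}"
  using assms
proof (cases rule: icg_cases)
  case 1
  then show ?thesis
    using that[of "{}"] icg_eq_interp[of 0 t] by (simp add: interp_def root_poly_def)
next
  case (2 k)
  have "0 < t - real k" using 2 by simp
  with 2(1) obtain S where S: "finite S" "\<forall>a\<in>S. a > 0" "card S = Suc k"
    "interp k (t - real k) = root_poly S" by (rule interp_eq_root_poly)
  have "S \<noteq> {}" using S(3) by auto
  moreover have "icg t = root_poly S" using icg_eq_interp[of k t] 2 S(4) by simp
  ultimately show ?thesis using that S(1,2) by blast
qed

text \<open>For t > 0 the zero set is finite and nonempty, so the \<open>LEAST\<close> in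
  \<open>first_zero\<close> is its minimum. At t = 0 no zero exists, and the convention r_{0,<} = 1
  agrees with truncating the constant 1.\<close>

lemma r_less_eq_trunc_poly:
  assumes t: "t \<in> {0..real (card nodes)}" and x: "0 \<le> x"
  shows "r_less lam u Y t x = trunc_poly (icg t) x"
proof -
  obtain S where S: "finite S" "\<forall>a\<in>S. a > 0" "icg t = root_poly S" "t > 0 \<longrightarrow> S \<noteq> {}"
    using t by (rule icg_root_poly)
  show ?thesis
  proof (cases "t = 0")
    case True
    have "icg t = 1" using True icg_eq_interp[of 0 t] by (simp add: interp_def)
    then show ?thesis using True by (simp add: r_less_def trunc_poly_def pos_upto_def)
  next
    case False
    then have "t > 0" using t by simp
    then have ne: "S \<noteq> {}" using S(4) by simp
    have root: "poly (icg t) y = 0 \<longleftrightarrow> y \<in> S" for y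
    proof -
      have "1 - y / a = 0 \<longleftrightarrow> y = a" if "a \<in> S" for a using S(2) that by auto
      then show ?thesis unfolding S(3) poly_root_poly prod_zero_iff[OF S(1)] by blast
    qed
    have "first_zero lam u Y t = Min S"
      unfolding first_zero_def
    proof (rule Least_equality)
      show "0 \<le> Min S \<and> poly (icg t) (Min S) = 0"
        using Min_in[OF S(1) ne] S(2) unfolding root by (auto simp: less_imp_le)
      show "Min S \<le> y" if "0 \<le> y \<and> poly (icg t) y = 0" for y
        using that S(1) unfolding root by simp
    qed
    moreover have "pos_upto (icg t) x \<longleftrightarrow> x < Min S"
      unfolding S(3) pos_upto_root_poly[OF S(1,2) x] using S(1) ne by simp
    ultimately show ?thesis using \<open>t > 0\<close> by (simp add: r_less_def trunc_poly_def)
  qed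
qed

lemma r_less_bounds:
  assumes "t \<in> {0..real (card nodes)}" "0 \<le> x"
  shows "0 \<le> r_less lam u Y t x" "r_less lam u Y t x \<le> 1"
    and "1 - r_less lam u Y t x \<le> abs_deriv0 lam u Y t * x"
    and "r_less lam u Y t x \<le> exp (- (abs_deriv0 lam u Y t * x))"
proof -
  obtain S where S: "finite S" "\<forall>a\<in>S. a > 0" "icg t = root_poly S" "t > 0 \<longrightarrow> S \<noteq> {}"
    using assms(1) by (rule icg_root_poly)
  show "0 \<le> r_less lam u Y t x" "r_less lam u Y t x \<le> 1"
    "1 - r_less lam u Y t x \<le> abs_deriv0 lam u Y t * x"
    "r_less lam u Y t x \<le> exp (- (abs_deriv0 lam u Y t * x))"
    unfolding r_less_eq_trunc_poly[OF assms] abs_deriv0_def S(3)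
    using S(1,2) assms(2)
    by (rule trunc_poly_le_1 one_minus_trunc_poly_le trunc_poly_le_exp)+
qed

lemma r_less_0: "r_less lam u Y 0 x = 1"
  by (simp add: r_less_def)

lemma icg_card_nodes:
  assumes "z \<in> nodes"
  shows "poly (icg (real (card nodes))) z = 0"
proof -
  obtain k where k: "card nodes = Suc k"
    using assms finite_nodes by (metis card_gt_0_iff empty_iff gr0_implies_Suc)
  then show ?thesis
    using icg_eq_interp[of k "real (Suc k)"] poly_r_card_Z[OF assms] by (simp add: interp_def)
qed

lemma r_less_card_nodes:
  assumes "z \<in> nodes"
  shows "r_less lam u Y (real (card nodes)) z = 0"
  using r_less_eq_trunc_poly[of "real (card nodes)" z] icg_card_nodes[OF assms] nodes_pos[OF assms]
  by (simp add: trunc_poly_def)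

lemma r_less_on_unit_interval:
  assumes k: "k < card nodes" and t: "t \<in> {real k..real (Suc k)}" and x: "0 \<le> x"
  shows "r_less lam u Y t x = trunc_poly (interp k (t - real k)) x"
proof -
  have "t \<in> {0..real (card nodes)}" using k t by auto
  then show ?thesis using r_less_eq_trunc_poly[OF _ x, of t] icg_eq_interp[of k t] t by simp
qed

section \<open>Dependence on t at a fixed point x\<close>

lemma antimono_r_less:
  assumes x: "0 \<le> x"
  shows "antimono_on {0..real (card nodes)} (\<lambda>t. r_less lam u Y t x)"
proof (rule antimono_on_unit_intervals, rule monotone_onI)
  fix k s t assume k: "k < card nodes" "s \<in> {real k..real (Suc k)}" "t \<in> {real k..real (Suc k)}" "s \<le> t"
  show "r_less lam u Y s x \<ge> r_less lam u Y t x"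
    unfolding r_less_on_unit_interval[OF k(1,2) x] r_less_on_unit_interval[OF k(1,3) x]
    using k x by (intro trunc_poly_interp_antimono) auto
qed

lemma continuous_r_less:
  assumes x: "0 \<le> x"
  shows "continuous_on {0..real (card nodes)} (\<lambda>t. r_less lam u Y t x)"
proof (rule continuous_on_unit_intervals)
  fix k assume k: "k < card nodes"
  \<comment> \<open>The branch condition does not contain t, so on this interval \<open>?F\<close>
    is either identically 0 or the positive part of an affine function of t.\<close>
  let ?F = "\<lambda>t. if pos_upto (cg_poly lam u Y k) x then max 0 (poly (interp k (t - real k)) x) else 0"
  have "continuous_on {real k..real (Suc k)} ?F"
    by (cases "pos_upto (cg_poly lam u Y k) x") (auto simp: poly_interp intro!: continuous_intros)
  moreover have "?F t = r_less lam u Y t x" if "t \<in> {real k..real (Suc k)}" for t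
    using that unfolding r_less_on_unit_interval[OF k that x]
    by (intro trunc_poly_interp[OF k _ _ x, symmetric]) auto
  ultimately show "continuous_on {real k..real (Suc k)} (\<lambda>t. r_less lam u Y t x)"
    by (rule continuous_on_eq)
qed

lemma continuous_poly_icg: "continuous_on {0..real (card nodes)} (\<lambda>t. poly (icg t) x)"
proof (rule continuous_on_unit_intervals)
  fix k
  have "continuous_on {real k..real (Suc k)} (\<lambda>t. poly (interp k (t - real k)) x)"
    unfolding poly_interp by (intro continuous_intros)
  moreover have "poly (interp k (t - real k)) x = poly (icg t) x" if "t \<in> {real k..real (Suc k)}" for t
    using icg_eq_interp[of k t] that by simp
  ultimately show "continuous_on {real k..real (Suc k)} (\<lambda>t. poly (icg t) x)"
    by (rule continuous_on_eq)
qed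

section \<open>Error terms as finite sums over the spectrum\<close>

lemma norm_sqrt_r_less:
  assumes "t \<in> {0..real (card nodes)}"
  shows "(norm (spec_app lam u (\<lambda>x. sqrt (r_less lam u Y t x)) v))\<^sup>2
    = (\<Sum>i=1..CARD('d). r_less lam u Y t ((lam i)\<^sup>2) * (v \<bullet> u i)\<^sup>2)"
  unfolding norm_spec_app[OF orthonormal] using r_less_bounds(1)[OF assms] by simp

lemma stoch_err_eq:
  assumes "t \<in> {0..real (card nodes)}"
  shows "stoch_err lam u Y \<xi> t
    = (\<Sum>i=1..CARD('d). (1 - r_less lam u Y t ((lam i)\<^sup>2)) * (\<xi> \<bullet> u i)\<^sup>2)"
  unfolding stoch_err_def norm_spec_app[OF orthonormal] using r_less_bounds(2)[OF assms] by simp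

lemma sq_residual_eq:
  "sq_residual lam u Y t = (\<Sum>i=1..CARD('d). (poly (icg t) ((lam i)\<^sup>2))\<^sup>2 * (Y \<bullet> u i)\<^sup>2)"
  unfolding sq_residual_def norm_spec_app[OF orthonormal] ..

lemma sq_residual_le:
  assumes t: "t \<in> {0..real (card nodes)}"
  shows "sq_residual lam u Y t \<le> (norm (spec_app lam u (\<lambda>x. sqrt (r_less lam u Y t x)) Y))\<^sup>2"
proof -
  have "(\<Sum>z\<in>nodes. weight z * (poly (icg t) z)\<^sup>2) \<le> (\<Sum>z\<in>nodes. weight z * r_less lam u Y t z)"
    using t
  proof (cases rule: icg_cases)
    case 1
    then show ?thesis using icg_eq_interp[of 0 t] by (simp add: interp_def r_less_def)
  next
    case (2 k)
    have "(\<Sum>z\<in>nodes. weight z * r_less lam u Y t z)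
      = (\<Sum>z\<in>nodes. weight z * trunc_poly (interp k (t - real k)) z)"
      using 2 nodes_pos by (intro sum.cong) (auto simp: r_less_on_unit_interval less_imp_le)
    then show ?thesis
      using residual_le_trunc[of k "t - real k"] icg_eq_interp[of k t] 2 by simp
  qed
  then show ?thesis unfolding norm_sqrt_r_less[OF t] sq_residual_eq
    sum_weight[of "\<lambda>z. (poly (icg t) z)\<^sup>2"] sum_weight .
qed

lemma norm_sq_eq_sum: "(norm v)\<^sup>2 = (\<Sum>i=1..CARD('d). (v \<bullet> u i)\<^sup>2)"
  using norm_spec_app[OF orthonormal, of lam "\<lambda>_. 1" v] spec_app_1[OF orthonormal] by simp

end

theorem lemma5p3:
  fixes A :: "real^'p^'d" and f :: "real^'p" and g \<xi> Y :: "real^'d"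
    and lam :: "nat \<Rightarrow> real" and u :: "nat \<Rightarrow> real^'d" and v :: "nat \<Rightarrow> real^'p" and d :: nat
  assumes "CARD('d) \<ge> 3" and "CARD('p) \<ge> CARD('d)" and "rank A = CARD('d)"
    and "compact_svd A lam u v"
    and "d = card (lam ` {1..CARD('d)})"
    and "g = A *v f" and "Y = g + \<xi>"
    and "\<forall>i\<in>{1..CARD('d)}. (\<Sum>j | j \<in> {1..CARD('d)} \<and> lam j = lam i. (Y \<bullet> u j)\<^sup>2) > 0"
  shows "(\<xi> = 0 \<longrightarrow> (\<forall>t\<in>{0..real d}. stoch_err lam u Y \<xi> t = 0))
    \<and> (stoch_err lam u Y \<xi> 0 = 0 \<and> stoch_err lam u Y \<xi> (real d) = (norm \<xi>)\<^sup>2)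
    \<and> (\<forall>t\<in>{0..real d}. stoch_err lam u Y \<xi> t
          \<le> (norm (spec_app lam u (\<lambda>x. min (sqrt (abs_deriv0 lam u Y t * x)) 1) \<xi>))\<^sup>2)
    \<and> mono_on {0..real d} (stoch_err lam u Y \<xi>)
    \<and> continuous_on {0..real d} (stoch_err lam u Y \<xi>)
    \<and> (A *v f = 0 \<longrightarrow> (\<forall>t\<in>{0..real d}. approx_err lam u Y g t \<le> 0))
    \<and> (approx_err lam u Y g 0 = (norm (A *v f))\<^sup>2 \<and> approx_err lam u Y g (real d) = 0)
    \<and> (\<forall>t\<in>{0..real d}.
          approx_err lam u Y g t
            \<le> (norm (spec_app lam u (\<lambda>x. sqrt (r_less lam u Y t x)) g))\<^sup>2
        \<and> (norm (spec_app lam u (\<lambda>x. sqrt (r_less lam u Y t x)) g))\<^sup>2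
            \<le> (norm (spec_app lam u (\<lambda>x. exp (- (abs_deriv0 lam u Y t * x / 2))) g))\<^sup>2)
    \<and> antimono_on {0..real d}
        (\<lambda>t. (norm (spec_app lam u (\<lambda>x. sqrt (r_less lam u Y t x)) g))\<^sup>2)
    \<and> continuous_on {0..real d} (approx_err lam u Y g)"
proof -
  interpret cg_setting lam u Y
    using assms(3,4,8) by unfold_locales (auto simp: compact_svd_def)
  have d: "real d = real (card nodes)" using card_nodes assms(5) by simp
  let ?r = "\<lambda>t i. r_less lam u Y t ((lam i)\<^sup>2)"
  have zero: "0 \<in> {0..real (card nodes)}" and last: "real (card nodes) \<in> {0..real (card nodes)}"
    by auto
  have r_last: "?r (real (card nodes)) i = 0" if "i \<in> {1..CARD('d)}" for i
    using r_less_card_nodes lam_sq_in_nodes[OF that] by blast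
  \<comment> \<open>The first summand of \<open>approx_err\<close> is the bound itself, so the claim
    is that the other two add up to something nonpositive. For g = 0 the bound vanishes, which gives
    (f).\<close>
  have approx_le: "approx_err lam u Y g t \<le> (norm (spec_app lam u (\<lambda>x. sqrt (r_less lam u Y t x)) g))\<^sup>2"
    if "t \<in> {0..real (card nodes)}" for t
    using sq_residual_le[OF that] by (simp add: approx_err_def)
  have anti: "?r t i \<le> ?r s i"
    if "s \<in> {0..real (card nodes)}" "t \<in> {0..real (card nodes)}" "s \<le> t" for s t i
    using monotone_onD[OF antimono_r_less that] by simp
  have a: "\<forall>t\<in>{0..real (card nodes)}. stoch_err lam u Y \<xi> t = 0" if "\<xi> = 0"
    using that by (simp add: stoch_err_eq)
  have b: "stoch_err lam u Y \<xi> 0 = 0" "stoch_err lam u Y \<xi> (real (card nodes)) = (norm \<xi>)\<^sup>2"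
    unfolding stoch_err_eq[OF zero] stoch_err_eq[OF last] norm_sq_eq_sum
    by (auto simp: r_less_0 intro!: sum.cong r_last)
  have c: "stoch_err lam u Y \<xi> t
          \<le> (norm (spec_app lam u (\<lambda>x. min (sqrt (abs_deriv0 lam u Y t * x)) 1) \<xi>))\<^sup>2"
    if t: "t \<in> {0..real (card nodes)}" for t
    unfolding stoch_err_eq[OF t] norm_spec_app[OF orthonormal]
  proof (intro sum_mono mult_right_mono)
    fix i
    let ?x = "abs_deriv0 lam u Y t * (lam i)\<^sup>2"
    have "0 \<le> ?x" by (simp add: abs_deriv0_def)
    then have "(min (sqrt ?x) 1)\<^sup>2 = min ?x 1" by (simp add: min_def)
    then show "1 - ?r t i \<le> (min (sqrt ?x) 1)\<^sup>2"
      using r_less_bounds(1,3)[OF t, of "(lam i)\<^sup>2"] by simp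
  qed simp
  have mono: "mono_on {0..real (card nodes)} (stoch_err lam u Y \<xi>)"
  proof (rule monotone_onI)
    fix s t assume st: "s \<in> {0..real (card nodes)}" "t \<in> {0..real (card nodes)}" "s \<le> t"
    show "stoch_err lam u Y \<xi> s \<le> stoch_err lam u Y \<xi> t"
      unfolding stoch_err_eq[OF st(1)] stoch_err_eq[OF st(2)]
      using anti[OF st] by (intro sum_mono mult_right_mono) auto
  qed
  have cont: "continuous_on {0..real (card nodes)} (stoch_err lam u Y \<xi>)"
  proof -
    have "continuous_on {0..real (card nodes)}
        (\<lambda>t. \<Sum>i=1..CARD('d). (1 - ?r t i) * (\<xi> \<bullet> u i)\<^sup>2)"
      by (intro continuous_intros continuous_r_less) simp
    then show ?thesis by (rule continuous_on_eq) (simp add: stoch_err_eq)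
  qed
  have spec_0: "spec_app lam u h 0 = 0" for h by (simp add: spec_app_def)
  have neg: "approx_err lam u Y g t \<le> 0" if "A *v f = 0" "t \<in> {0..real (card nodes)}" for t
    using approx_le[OF that(2)] that(1) assms(6) by (simp add: spec_0)
  have "icg 0 = 1" using icg_eq_interp[of 0 0] by (simp add: interp_def)
  then have approx_0: "approx_err lam u Y g 0 = (norm (A *v f))\<^sup>2"
    unfolding approx_err_def norm_sqrt_r_less[OF zero] sq_residual_eq norm_sq_eq_sum
    by (simp add: r_less_0 assms(6) spec_app_1[OF orthonormal])
  have approx_last: "approx_err lam u Y g (real (card nodes)) = 0"
  proof -
    have "poly (icg (real (card nodes))) ((lam i)\<^sup>2) = 0" if "i \<in> {1..CARD('d)}" for i
      using icg_card_nodes lam_sq_in_nodes[OF that] by blast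
    then show ?thesis
      unfolding approx_err_def norm_sqrt_r_less[OF last] sq_residual_eq using r_last by simp
  qed
  have le_exp: "(norm (spec_app lam u (\<lambda>x. sqrt (r_less lam u Y t x)) g))\<^sup>2
            \<le> (norm (spec_app lam u (\<lambda>x. exp (- (abs_deriv0 lam u Y t * x / 2))) g))\<^sup>2"
    if t: "t \<in> {0..real (card nodes)}" for t
    unfolding norm_sqrt_r_less[OF t] unfolding norm_spec_app[OF orthonormal]
  proof (rule sum_mono, rule mult_right_mono)
    fix i
    \<comment> \<open>Squaring the spectral coefficient doubles the exponent, which accounts for the
      factor 1/2 in (h).\<close>
    show "?r t i \<le> (exp (- (abs_deriv0 lam u Y t * (lam i)\<^sup>2 / 2)))\<^sup>2"
      using r_less_bounds(4)[OF t, of "(lam i)\<^sup>2"] by (simp add: exp_double[symmetric])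
  qed simp
  have anti_bound: "antimono_on {0..real (card nodes)}
        (\<lambda>t. (norm (spec_app lam u (\<lambda>x. sqrt (r_less lam u Y t x)) g))\<^sup>2)"
  proof (rule monotone_onI)
    fix s t assume st: "s \<in> {0..real (card nodes)}" "t \<in> {0..real (card nodes)}" "s \<le> t"
    show "(norm (spec_app lam u (\<lambda>x. sqrt (r_less lam u Y s x)) g))\<^sup>2
      \<ge> (norm (spec_app lam u (\<lambda>x. sqrt (r_less lam u Y t x)) g))\<^sup>2"
      unfolding norm_sqrt_r_less[OF st(1)] norm_sqrt_r_less[OF st(2)]
      using anti[OF st] by (intro sum_mono mult_right_mono) auto
  qed
  have cont_approx: "continuous_on {0..real (card nodes)} (approx_err lam u Y g)"
  proof -
    have "continuous_on {0..real (card nodes)}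
        (\<lambda>t. (\<Sum>i=1..CARD('d). ?r t i * (g \<bullet> u i)\<^sup>2)
          + (\<Sum>i=1..CARD('d). (poly (icg t) ((lam i)\<^sup>2))\<^sup>2 * (Y \<bullet> u i)\<^sup>2)
          - (\<Sum>i=1..CARD('d). ?r t i * (Y \<bullet> u i)\<^sup>2))"
      by (intro continuous_intros continuous_r_less continuous_poly_icg) simp_all
    then show ?thesis
      by (rule continuous_on_eq) (simp add: approx_err_def norm_sqrt_r_less sq_residual_eq)
  qed
  show ?thesis
    unfolding d
    using a b c mono cont neg approx_0 approx_last approx_le le_exp anti_bound cont_approx by blast
qed

end
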